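(* The following bounds hold: \begin{enumerate} \item $d_1(n) = \Theta(\log n)$ (as $n\to\infty$); \item $\frac{1}{2}(n-1) \le d_3(n) \le 5\left\lceil\frac{n}{6}\right\rceil-1$ for every positive integer $n$; \item $\frac{2}{3}(n-1) \le d_5(n) \le n-1$ for every positive integer $n$; \item $d_k(n) = n-1$ for every positive integer $n$ otherwise, that is, if $k=2$, $k=4$, or $k\ge 6$. \end{enumerate}
   Context: Let $k\ge 1$ be an integer. For a point $p\in\mathbb{R}^2$ and $i=0,\dots,k-1$, let $\ell_i(p)$ be the ray from $p$ in direction $(\cos(2\pi i/k),\sin(2\pi i/k))$. These $k$ rays (the sector-bounding rays of $p$) divide the plane around $p$ into $k$ equal sectors $s_0(p),\dots,s_{k-1}(p)$, where $s_i(p)$ is the sector bounded by $\ell_i(p)$ and the next ray $\ell_{i+1}(p)$ counterclockwise (indices mod $k$; for $k=1$ the single sector is the whole plane around $p$). All point sets are finite and in general position (with respect to $k$): no point of the set lies on a sector-bounding ray of another point of the set, and there are no three distinct points $p,q,q'$ in the set such that $q,q'$ lie in the same sector of $p$ and are at the same Euclidean distance from $p$. Given a point set $P$ and a linear order $p_1,\dots,p_n$ of $P$, the corresponding $k$-sector ordered Yao graph is the directed graph on $P$ in which, for every $j$ and every $i$ such that the sector $s_i(p_j)$ contains at least one of the predecessors $p_1,\dots,p_{j-1}$, there is exactly one edge from $p_j$ to its closest (in Euclidean distance) predecessor in $s_i(p_j)$; there are no other edges. $d_k(n)$ is the maximum integer such that for every $n$-point set in the plane there exists an order for which the corresponding $k$-sector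 ordered Yao graph has maximum indegree at least $d_k(n)$. *)

theory Defs
  imports
    "HOL-Analysis.Analysis"
    "HOL-Library.Landau_Symbols"
    "Graph_Theory.Digraph"
begin

definition unit_dir :: "real \<Rightarrow> real ^ 2" where
  "unit_dir t = vector [cos t, sin t]"

definition bounding_ray :: "nat \<Rightarrow> nat \<Rightarrow> real ^ 2 \<Rightarrow> (real ^ 2) set" where
  "bounding_ray k i p = {p + r *\<^sub>R unit_dir (2 * pi * real i / real k) | r. 0 \<le> r}"

(* Each sector contains its first bounding ray and not the next one, and no sector of p contains
   p; so the sectors with i < k partition the plane without p, also for k = 1. For point sets in
   general position it does not matter which sectors the bounding rays are assigned to. *)
definition sector :: "nat \<Rightarrow> nat \<Rightarrow> real ^ 2 \<Rightarrow> (real ^ 2) set" where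
  "sector k i p = {p + r *\<^sub>R unit_dir t | r t.
     0 < r \<and> 2 * pi * real i / real k \<le> t \<and> t < 2 * pi * (real i + 1) / real k}"

definition general_position :: "nat \<Rightarrow> (real ^ 2) set \<Rightarrow> bool" where
  "general_position k P \<longleftrightarrow>
     (\<forall>p\<in>P. \<forall>q\<in>P. p \<noteq> q \<longrightarrow> (\<forall>i<k. q \<notin> bounding_ray k i p)) \<and>
     \<not> (\<exists>p\<in>P. \<exists>q\<in>P. \<exists>q'\<in>P. p \<noteq> q \<and> p \<noteq> q' \<and> q \<noteq> q' \<and>
         (\<exists>i<k. q \<in> sector k i p \<and> q' \<in> sector k i p) \<and> dist p q = dist p q')"

(* A linear order p_1, ..., p_n of a finite point set is given as a list without repetitions;
   the predecessors of ps ! j are the entries with smaller index. *)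
definition ordered_yao_graph ::
  "nat \<Rightarrow> (real ^ 2) list \<Rightarrow> (real ^ 2, (real ^ 2) \<times> (real ^ 2)) pre_digraph" where
  "ordered_yao_graph k ps =
     \<lparr> verts = set ps,
       arcs = {(ps ! j, ps ! m) | j m. j < length ps \<and> m < j \<and>
         (\<exists>i<k. ps ! m \<in> sector k i (ps ! j) \<and>
            (\<forall>l<j. ps ! l \<in> sector k i (ps ! j) \<longrightarrow>
               dist (ps ! j) (ps ! m) \<le> dist (ps ! j) (ps ! l)))},
       tail = fst, head = snd \<rparr>"

definition max_in_degree :: "('a, 'b) pre_digraph \<Rightarrow> nat" where
  "max_in_degree G = Max (in_degree G ` verts G)"

(* Meaningful for n > 0 and k > 0: an empty graph has no maximum indegree. *)
definition d_yao :: "nat \<Rightarrow> nat \<Rightarrow> nat" where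
  "d_yao k n = (GREATEST d. \<forall>P. finite P \<and> card P = n \<and> general_position k P \<longrightarrow>
     (\<exists>ps. distinct ps \<and> set ps = P \<and> d \<le> max_in_degree (ordered_yao_graph k ps)))"

end

theory Submission
  imports Defs
begin

text \<open>
  Fix a point \<open>p\<close>. Another point \<open>q\<close>, inserted after \<open>p\<close>, sends its edge to \<open>p\<close> exactly if no
  earlier point \<open>r\<close> lies in the sector of \<open>q\<close> containing \<open>p\<close> and is closer to \<open>q\<close> than \<open>p\<close> is. If
  \<open>r\<close> does so, \<open>r\<close> blocks \<open>q\<close> and must come after \<open>q\<close>. Inserting \<open>p\<close> first and all irrelevant
  points last shows that the largest indegree that \<open>p\<close> can get over all orders is the length of a
  longest list of other points in which no entry blocks a later one (\<open>max_in_degree_ge\<close>,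
  \<open>max_in_degree_attained\<close>). So \<open>d_yao k n\<close> is the minimum over all \<open>P\<close> of the maximum over all \<open>p\<close>
  of this length. A set of points can be listed in this way as soon as some real function strictly
  decreases from \<open>q\<close> to \<open>r\<close> whenever \<open>r\<close> blocks \<open>q\<close> (\<open>unblocked_of_potential\<close>).

  For at least six sectors the distance to an arbitrary \<open>p\<close> is such a function: the angle \<open>r q p\<close> is
  at most \<open>pi/3\<close>, so \<open>p r\<close> is shorter than \<open>p q\<close>. For two or four sectors, take the highest point
  \<open>p\<close>; every other point sees \<open>p\<close> in a sector above it, so blocking points are higher. For
  three sectors, the highest point is seen in only two different sectors, and points that
  see it in the same sector are ordered by a linear functional; the larger class has half of
  the points. For five sectors, the leftmost point is seen in three consecutive sectors, and
  any two of the three classes can be ordered together: adjacent ones by a linear functional, the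
  two outer ones by the distance to \<open>p\<close> (\<open>opposite_sectors_closer\<close>). Hence two thirds of the points
  can point to \<open>p\<close>.

  The upper bound for three sectors comes from six clusters, arranged in three pairs around a
  triangle such that for each point \<open>p\<close> the two clusters of some other pair block each other in both
  directions (\<open>witness_pair_blocks\<close>). From each such two-cycle at most one point can point to \<open>p\<close>.

  For one sector, a list without blocking essentially has distances to \<open>p\<close> halving from entry to
  entry. For nearly equally spaced points near a line this leaves only logarithmically many points
  (\<open>d_yao_1_le\<close>). Conversely, every point set contains a constant fraction of its points in a cell
  that is small compared with the diameter; recursion in the cell, together with one far
  point per step, gives a logarithmic list (\<open>nearest_neighbour_chain\<close>).

  The point sets for the upper bounds are given by strict inequalities, so they can be
  moved into general position inside small boxes (\<open>general_position_in_open_sets\<close>).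
\<close>

section \<open>Polar coordinates and sectors\<close>

lemma unit_dir_nth [simp]: "unit_dir t $ 1 = cos t" "unit_dir t $ 2 = sin t"
  by (simp_all add: unit_dir_def)

lemma inner_real2: "(v::real^2) \<bullet> w = v$1 * w$1 + v$2 * w$2"
  by (simp add: inner_vec_def sum_2)

lemma norm_real2: "(norm (v::real^2))\<^sup>2 = (v$1)\<^sup>2 + (v$2)\<^sup>2"
  unfolding power2_norm_eq_inner by (simp add: inner_real2 power2_eq_square)

lemma norm_unit_dir [simp]: "norm (unit_dir t) = 1"
proof -
  have "(norm (unit_dir t))\<^sup>2 = 1"
    by (simp add: norm_real2)
  thus ?thesis
    using norm_ge_zero[of "unit_dir t"] unfolding power2_eq_1_iff by linarith
qed

lemma inner_unit_dir: "unit_dir s \<bullet> unit_dir t = cos (s - t)"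
  by (simp add: inner_real2 cos_diff)

lemma dist_sq_polar:
  "(dist (q + a *\<^sub>R unit_dir s) (q + b *\<^sub>R unit_dir t))\<^sup>2 = a\<^sup>2 + b\<^sup>2 - 2 * a * b * cos (s - t)"
proof -
  have "(dist (q + a *\<^sub>R unit_dir s) (q + b *\<^sub>R unit_dir t))\<^sup>2
      = (norm (a *\<^sub>R unit_dir s - b *\<^sub>R unit_dir t))\<^sup>2"
    by (simp add: dist_norm)
  also have "\<dots> = a\<^sup>2 + b\<^sup>2 - 2 * a * b * cos (s - t)"
    unfolding power2_norm_eq_inner
    using cos_minus[of "s - t"]
    by (simp add: inner_diff_left inner_diff_right inner_unit_dir power2_eq_square algebra_simps)
  finally show ?thesis .
qed

lemma polar_decomposition:
  fixes v :: "real^2"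
  assumes "v \<noteq> 0"
  obtains r t where "0 < r" "0 \<le> t" "t < 2 * pi" "v = r *\<^sub>R unit_dir t"
proof -
  have n: "norm v > 0" using assms by simp
  have "(v$1 / norm v)\<^sup>2 + (v$2 / norm v)\<^sup>2 = (norm v)\<^sup>2 / (norm v)\<^sup>2"
    unfolding norm_real2[of v] power_divide add_divide_distrib ..
  hence "(v$1 / norm v)\<^sup>2 + (v$2 / norm v)\<^sup>2 = 1" using n by simp
  then obtain t where t: "0 \<le> t" "t < 2 * pi" "v$1 / norm v = cos t" "v$2 / norm v = sin t"
    by (rule sincos_total_2pi)
  have "v$1 = norm v * cos t" "v$2 = norm v * sin t"
    unfolding t(3,4)[symmetric] using n by simp_all
  hence "v = norm v *\<^sub>R unit_dir t"
    by (simp add: vec_eq_iff forall_2)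
  with t(1,2) n that[of "norm v" t] show ?thesis by blast
qed

lemma polar_unique:
  assumes "r *\<^sub>R unit_dir t = r' *\<^sub>R unit_dir t'" "0 < r" "0 < r'"
    and "0 \<le> t" "t < 2 * pi" "0 \<le> t'" "t' < 2 * pi"
  shows "t = t'"
proof -
  have "norm (r *\<^sub>R unit_dir t) = norm (r' *\<^sub>R unit_dir t')" using assms(1) by (rule arg_cong)
  hence "r = r'" using assms(2,3) by simp
  hence u: "unit_dir t = unit_dir t'" using assms by simp
  have "sin t = sin t' \<and> cos t = cos t'"
    using arg_cong[OF u, of "\<lambda>v. v$1"] arg_cong[OF u, of "\<lambda>v. v$2"] by simp
  then obtain n :: int where n: "t = t' + 2 * pi * n" unfolding sin_cos_eq_iff by blast
  have "\<bar>2 * pi * n\<bar> < 2 * pi * 1" using n assms by linarith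
  hence "\<bar>real_of_int n\<bar> < 1" by (simp add: abs_mult)
  hence "n = 0" by linarith
  thus ?thesis using n by simp
qed

lemma sector_angle_bounds:
  assumes "0 < k" "i < k" "2 * pi * real i / real k \<le> t" "t < 2 * pi * (real i + 1) / real k"
  shows "0 \<le> t" "t < 2 * pi"
proof -
  have "0 \<le> 2 * pi * real i / real k" by simp
  thus "0 \<le> t" using assms by linarith
  have "(real i + 1) \<le> real k" using assms by linarith
  hence "2 * pi * (real i + 1) \<le> 2 * pi * real k" by (intro mult_left_mono) auto
  hence "2 * pi * (real i + 1) / real k \<le> 2 * pi"
    using assms(1) by (simp add: pos_divide_le_eq)
  thus "t < 2 * pi" using assms by linarith
qed

lemma mem_sectorE:
  assumes "p \<in> sector k i q"
  obtains r t where "p = q + r *\<^sub>R unit_dir t" "0 < r"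
    "2 * pi * real i / real k \<le> t" "t < 2 * pi * (real i + 1) / real k"
  using assms unfolding sector_def by blast

lemma not_in_own_sector: "p \<notin> sector k i p"
proof
  assume "p \<in> sector k i p"
  then obtain r t where "p = p + r *\<^sub>R unit_dir t" "0 < r" by (rule mem_sectorE)
  hence "r *\<^sub>R unit_dir t = 0" "0 < r" by simp_all
  hence "norm (r *\<^sub>R unit_dir t) = 0" "0 < r" by simp_all
  thus False by simp
qed

lemma sectors_cover:
  assumes "0 < k" "p \<noteq> q"
  obtains i where "i < k" "p \<in> sector k i q"
proof -
  obtain r t where rt: "0 < r" "0 \<le> t" "t < 2 * pi" "p - q = r *\<^sub>R unit_dir t"
    using polar_decomposition[of "p - q"] assms by auto
  define y where "y = t * real k / (2 * pi)"
  have y: "0 \<le> y" "2 * pi * y = t * real k" using rt by (simp_all add: y_def)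
  define i where "i = nat \<lfloor>y\<rfloor>"
  have "real i = of_int \<lfloor>y\<rfloor>" using y(1) by (simp add: i_def)
  hence i1: "real i \<le> y" and i2: "y < real i + 1" by linarith+
  have "2 * pi * y < 2 * pi * real k" unfolding y(2) using rt(3) assms(1) by simp
  hence "y < real k" by (simp add: mult_less_cancel_left_pos)
  hence "i < k" using i1 by linarith
  moreover have "p \<in> sector k i q"
    unfolding sector_def
  proof (intro CollectI exI conjI)
    show "p = q + r *\<^sub>R unit_dir t" using rt(4) by (simp add: algebra_simps)
    have "2 * pi * real i \<le> t * real k" "t * real k < 2 * pi * (real i + 1)"
      unfolding y(2)[symmetric] using i1 i2 by (simp_all add: mult_less_cancel_left_pos)
    thus "2 * pi * real i / real k \<le> t" "t < 2 * pi * (real i + 1) / real k"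
      using assms(1) by (simp_all add: pos_divide_le_eq pos_less_divide_eq)
  qed (rule rt(1))
  ultimately show ?thesis using that by blast
qed

lemma sectors_disjoint:
  assumes "p \<in> sector k i q" "p \<in> sector k j q" "i < k" "j < k"
  shows "i = j"
proof -
  have k: "0 < k" using assms by simp
  obtain r t where 1: "p = q + r *\<^sub>R unit_dir t" "0 < r"
    "2 * pi * real i / real k \<le> t" "t < 2 * pi * (real i + 1) / real k"
    using assms(1) by (rule mem_sectorE)
  obtain r' t' where 2: "p = q + r' *\<^sub>R unit_dir t'" "0 < r'"
    "2 * pi * real j / real k \<le> t'" "t' < 2 * pi * (real j + 1) / real k"
    using assms(2) by (rule mem_sectorE)
  have "t = t'"
  proof (rule polar_unique)
    show "r *\<^sub>R unit_dir t = r' *\<^sub>R unit_dir t'" using 1(1) 2(1) by (metis add_left_cancel)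
  qed (use 1(2) 2(2) sector_angle_bounds[OF k assms(3) 1(3,4)]
      sector_angle_bounds[OF k assms(4) 2(3,4)] in blast)+
  have "2 * pi * real i / real k < 2 * pi * (real j + 1) / real k"
    using 1(3) 2(4) unfolding \<open>t = t'\<close> by (rule le_less_trans)
  moreover have "2 * pi * real j / real k < 2 * pi * (real i + 1) / real k"
    using 2(3) 1(4) unfolding \<open>t = t'\<close> by (rule le_less_trans)
  ultimately have "2 * pi * real i < 2 * pi * (real j + 1)" "2 * pi * real j < 2 * pi * (real i + 1)"
    using k by (simp_all only: divide_less_cancel of_nat_0_less_iff)
  hence "real i < real j + 1" "real j < real i + 1"
    by (simp_all only: mult_less_cancel_left_pos pi_gt_zero mult_pos_pos zero_less_numeral)
  thus ?thesis by linarith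
qed

lemma sector_1: "q \<in> sector 1 0 p \<longleftrightarrow> q \<noteq> p"
  using sectors_cover[of 1 q p] not_in_own_sector[of p 1 0] by auto

text \<open>
  A sector contains its first bounding ray. General position keeps points off that ray, which
  matters where a coordinate vanishes along it.
\<close>
lemma open_sector_of_general_position:
  assumes "general_position k P" "p \<in> P" "q \<in> P" "i < k" "p \<in> sector k i q"
  obtains r t where "p = q + r *\<^sub>R unit_dir t" "0 < r"
    "2 * pi * real i / real k < t" "t < 2 * pi * (real i + 1) / real k"
proof -
  obtain r t where 1: "p = q + r *\<^sub>R unit_dir t" "0 < r"
    "2 * pi * real i / real k \<le> t" "t < 2 * pi * (real i + 1) / real k"
    using assms(5) by (rule mem_sectorE)
  have "q \<noteq> p" using assms(5) not_in_own_sector[of q k i] by auto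
  moreover have "\<forall>p\<in>P. \<forall>q\<in>P. p \<noteq> q \<longrightarrow> (\<forall>i<k. q \<notin> bounding_ray k i p)"
    using assms(1) unfolding general_position_def by (rule conjunct1)
  ultimately have "p \<notin> bounding_ray k i q" using assms(2-4) by simp
  moreover have "p \<in> bounding_ray k i q" if "t = 2 * pi * real i / real k"
    unfolding bounding_ray_def mem_Collect_eq using 1(1,2) that less_imp_le by metis
  ultimately have "t \<noteq> 2 * pi * real i / real k" by blast
  thus ?thesis using that 1 by simp
qed

section \<open>Indegrees as orders compatible with a blocking relation\<close>

text \<open>
  The obstruction to an edge from \<open>q\<close> to \<open>p\<close>: such an edge forces every \<open>r\<close> that blocks \<open>q\<close> to come
  after \<open>q\<close>.
\<close>
definition blocks :: "nat \<Rightarrow> real^2 \<Rightarrow> real^2 \<Rightarrow> real^2 \<Rightarrow> bool" where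
  "blocks k p q r \<longleftrightarrow> (\<exists>i<k. p \<in> sector k i q \<and> r \<in> sector k i q \<and> dist q r < dist q p)"

text \<open>
  The list is an insertion order, so in the relation the entry \<open>r\<close> precedes the entry \<open>q\<close>.
\<close>
definition unblocked :: "nat \<Rightarrow> real^2 \<Rightarrow> (real^2) list \<Rightarrow> bool" where
  "unblocked k p qs \<longleftrightarrow> distinct qs \<and> p \<notin> set qs \<and> sorted_wrt (\<lambda>r q. \<not> blocks k p q r) qs"

lemma finite_in_arcs_ordered_yao_graph: "finite (in_arcs (ordered_yao_graph k ps) p)"
proof (rule finite_subset)
  show "in_arcs (ordered_yao_graph k ps) p \<subseteq> set ps \<times> set ps"
    by (auto simp: in_arcs_def ordered_yao_graph_def)
qed simp

text \<open>
  The points to be inserted after \<open>p\<close> come in the order \<open>qs\<close>, all others at the end: edges depend only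
  on predecessors, so the late points cannot destroy an edge to \<open>p\<close>.
\<close>
lemma max_in_degree_ge:
  assumes "unblocked k p qs" "0 < k" "finite P" "p \<in> P" "set qs \<subseteq> P"
  shows "\<exists>ps. distinct ps \<and> set ps = P \<and> length qs \<le> max_in_degree (ordered_yao_graph k ps)"
proof -
  obtain rest where rest: "distinct rest" "set rest = P - insert p (set qs)"
    using finite_distinct_list[of "P - insert p (set qs)"] assms(3) by auto
  define ps where "ps = p # qs @ rest"
  let ?G = "ordered_yao_graph k ps"
  have ub: "distinct qs" "p \<notin> set qs" "sorted_wrt (\<lambda>r q. \<not> blocks k p q r) qs"
    using assms(1) unfolding unblocked_def by auto
  have ps: "distinct ps" "set ps = P" using rest ub assms unfolding ps_def by auto
  have "(\<lambda>q. (q, p)) ` set qs \<subseteq> in_arcs ?G p"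
  proof (rule image_subsetI)
    fix q assume "q \<in> set qs"
    then obtain j where j: "j < length qs" "qs ! j = q" by (auto simp: in_set_conv_nth)
    have "p \<noteq> q" using ub \<open>q \<in> set qs\<close> by auto
    then obtain i where i: "i < k" "p \<in> sector k i q" using sectors_cover assms(2) by blast
    have psj: "ps ! Suc j = q" "ps ! 0 = p" unfolding ps_def using j by (simp_all add: nth_append)
    have "dist q p \<le> dist q (ps ! l)" if l: "l < Suc j" "ps ! l \<in> sector k i q" for l
    proof (cases l)
      case (Suc l')
      hence "ps ! l = qs ! l'" unfolding ps_def using j l by (simp add: nth_append)
      moreover have "\<not> blocks k p (qs ! j) (qs ! l')"
        using sorted_wrt_nth_less[OF ub(3), of l' j] Suc l j by simp
      ultimately show ?thesis using i l j unfolding blocks_def by force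
    qed (simp add: psj)
    moreover have "Suc j < length ps" unfolding ps_def using j by simp
    ultimately have "(ps ! Suc j, ps ! 0) \<in> arcs ?G"
      unfolding ordered_yao_graph_def using i psj by auto
    thus "(q, p) \<in> in_arcs ?G p" using psj by (simp add: in_arcs_def ordered_yao_graph_def)
  qed
  hence "card ((\<lambda>q. (q, p)) ` set qs) \<le> in_degree ?G p"
    unfolding in_degree_def by (rule card_mono[OF finite_in_arcs_ordered_yao_graph])
  also have "card ((\<lambda>q. (q, p)) ` set qs) = length qs"
    using ub by (simp add: card_image inj_on_def distinct_card)
  also have "in_degree ?G p \<le> max_in_degree ?G"
    unfolding max_in_degree_def using ps assms by (intro Max_ge) (auto simp: ordered_yao_graph_def)
  finally show ?thesis using ps by blast
qed

text \<open>
  Take the in-neighbours of a vertex \<open>p\<close> of maximum indegree in their order of insertion. Each of them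
  has \<open>p\<close> as a closest predecessor, so none is blocked by an earlier one.
\<close>
lemma max_in_degree_attained:
  assumes "distinct ps" "ps \<noteq> []"
  obtains p qs where "p \<in> set ps" "set qs \<subseteq> set ps" "unblocked k p qs"
    "length qs = max_in_degree (ordered_yao_graph k ps)"
proof -
  let ?G = "ordered_yao_graph k ps"
  have "Max (in_degree ?G ` verts ?G) \<in> in_degree ?G ` verts ?G"
    using assms by (intro Max_in) (auto simp: ordered_yao_graph_def)
  then obtain p where p: "p \<in> set ps" "max_in_degree ?G = in_degree ?G p"
    by (auto simp: max_in_degree_def ordered_yao_graph_def)
  define qs where "qs = filter (\<lambda>q. (q, p) \<in> arcs ?G) ps"
  have sub: "fst e \<in> set ps" "snd e \<in> set ps" if "e \<in> arcs ?G" for e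
    using that by (auto simp: ordered_yao_graph_def)
  have hd: "head ?G = snd" by (simp add: ordered_yao_graph_def)
  have "in_arcs ?G p = (\<lambda>q. (q, p)) ` set qs"
    unfolding qs_def in_arcs_def hd using sub by force
  hence "in_degree ?G p = card (set qs)"
    by (simp add: in_degree_def card_image inj_on_def)
  also have "\<dots> = length qs" using assms distinct_card[of qs] by (simp add: qs_def)
  finally have len: "length qs = max_in_degree ?G" using p by simp
  have "(p, p) \<notin> arcs ?G"
    using assms(1) by (auto simp: ordered_yao_graph_def nth_eq_iff_index_eq)
  moreover have "sorted_wrt (\<lambda>r q. (q, p) \<in> arcs ?G \<longrightarrow> \<not> blocks k p q r) ps"
    unfolding sorted_wrt_iff_nth_less
  proof (intro allI impI notI)
    fix l j assume lj: "l < j" "j < length ps" and arc: "(ps ! j, p) \<in> arcs ?G"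
      and bl: "blocks k p (ps ! j) (ps ! l)"
    from arc obtain j' m i where j': "ps ! j = ps ! j'" "p = ps ! m" "j' < length ps" "m < j'" "i < k"
      "ps ! m \<in> sector k i (ps ! j')"
      "\<forall>l<j'. ps ! l \<in> sector k i (ps ! j') \<longrightarrow> dist (ps ! j') (ps ! m) \<le> dist (ps ! j') (ps ! l)"
      unfolding ordered_yao_graph_def by auto
    have "j' = j" using nth_eq_iff_index_eq[OF assms(1) lj(2) j'(3)] j'(1) by blast
    have i: "p \<in> sector k i (ps ! j)"
      "\<And>l. l < j \<Longrightarrow> ps ! l \<in> sector k i (ps ! j) \<Longrightarrow> dist (ps ! j) p \<le> dist (ps ! j) (ps ! l)"
      using j'(6,7) unfolding \<open>j' = j\<close> j'(2) by blast+
    from bl obtain i' where i': "i' < k" "p \<in> sector k i' (ps ! j)" "ps ! l \<in> sector k i' (ps ! j)"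
      "dist (ps ! j) (ps ! l) < dist (ps ! j) p" unfolding blocks_def by blast
    have "i' = i" using i'(2) i(1) i'(1) j'(5) by (rule sectors_disjoint)
    thus False using i(2)[OF lj(1)] i'(3,4) by simp
  qed
  hence "sorted_wrt (\<lambda>r q. (q, p) \<in> arcs ?G \<longrightarrow> \<not> blocks k p q r) qs"
    unfolding qs_def by (rule sorted_wrt_filter)
  hence "sorted_wrt (\<lambda>r q. \<not> blocks k p q r) qs"
    by (rule sorted_wrt_mono_rel[rotated]) (auto simp: qs_def)
  ultimately have "unblocked k p qs"
    unfolding unblocked_def using assms by (auto simp: qs_def)
  moreover have "set qs \<subseteq> set ps" by (auto simp: qs_def)
  ultimately show ?thesis using that[of p qs] p(1) len by blast
qed

text \<open>
  The blocking relation on \<open>S\<close> has no cycle if a potential decreases along it; listing by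
  decreasing potential is then a topological order.
\<close>
lemma unblocked_of_potential:
  fixes f :: "real^2 \<Rightarrow> real"
  assumes "finite S" "p \<notin> S"
    and "\<And>q r. q \<in> S \<Longrightarrow> r \<in> S \<Longrightarrow> blocks k p q r \<Longrightarrow> f r < f q"
  obtains qs where "unblocked k p qs" "set qs = S" "length qs = card S"
proof -
  obtain xs where xs: "distinct xs" "set xs = S" using finite_distinct_list assms(1) by blast
  define qs where "qs = sort_key (\<lambda>q. - f q) xs"
  have set: "set qs = S" "distinct qs" using xs by (simp_all add: qs_def)
  have "sorted (map (\<lambda>q. - f q) qs)" unfolding qs_def by (rule sorted_sort_key)
  hence "sorted_wrt (\<lambda>r q. f q \<le> f r) qs" by (simp add: sorted_wrt_map)
  hence "sorted_wrt (\<lambda>r q. \<not> blocks k p q r) qs"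
    by (rule sorted_wrt_mono_rel[rotated]) (use assms(3) set in force)
  hence "unblocked k p qs" using set assms unfolding unblocked_def by auto
  thus ?thesis using that set distinct_card[of qs] by simp
qed

section \<open>Point sets in general position\<close>

lemma general_position_subset:
  assumes "general_position k P" "Q \<subseteq> P"
  shows "general_position k Q"
  using assms unfolding general_position_def by blast

text \<open>
  A new point spoils general position only if it lies on one of finitely many lines, circles and
  bisectors determined by the old points.
\<close>
lemma general_position_insert:
  assumes P: "general_position k P"
    and lines: "\<And>p i. p \<in> P \<Longrightarrow> i < k \<Longrightarrow>
      x \<notin> {p + s *\<^sub>R unit_dir (2 * pi * real i / real k) | s. True}"
    and circles: "\<And>p q. p \<in> P \<Longrightarrow> q \<in> P \<Longrightarrow> x \<notin> sphere p (dist p q)"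
    and bisectors: "\<And>p q. p \<in> P \<Longrightarrow> q \<in> P \<Longrightarrow> p \<noteq> q \<Longrightarrow> dist x p \<noteq> dist x q"
  shows "general_position k (insert x P)"
proof -
  have "q \<notin> bounding_ray k i p"
    if *: "p \<in> insert x P" "q \<in> insert x P" "p \<noteq> q" "i < k" for p q i
  proof
    assume "q \<in> bounding_ray k i p"
    then obtain s where s: "q = p + s *\<^sub>R unit_dir (2 * pi * real i / real k)" "0 \<le> s"
      unfolding bounding_ray_def by blast
    consider "p \<in> P" "q \<in> P" | "p \<in> P" "q = x" | "p = x" "q \<in> P" using * by blast
    thus False
    proof cases
      case 1 thus ?thesis using P * \<open>q \<in> bounding_ray k i p\<close> unfolding general_position_def by blast
    next
      case 2 thus ?thesis using lines[of p i] s * by blast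
    next
      \<comment> \<open>An old point on a ray of \<open>x\<close> puts \<open>x\<close> on the same line, in the opposite direction.\<close>
      case 3
      hence "x = q + (- s) *\<^sub>R unit_dir (2 * pi * real i / real k)" using s by simp
      thus ?thesis using lines[of q i] 3 * by blast
    qed
  qed
  moreover have False
    if *: "p \<in> insert x P" "q \<in> insert x P" "q' \<in> insert x P" "p \<noteq> q" "p \<noteq> q'" "q \<noteq> q'"
      "i < k" "q \<in> sector k i p" "q' \<in> sector k i p" "dist p q = dist p q'" for p q q' i
  proof -
    consider "p \<in> P" "q \<in> P" "q' \<in> P" | "p \<in> P" "q \<in> P" "q' = x" | "p \<in> P" "q = x" "q' \<in> P"
      | "p = x" "q \<in> P" "q' \<in> P" using * by blast
    thus False
    proof cases
      case 1 thus ?thesis using P * unfolding general_position_def by blast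
    next
      case 2 thus ?thesis using circles[of p q] * by simp
    next
      case 3 thus ?thesis using circles[of p q'] * by simp
    next
      case 4 thus ?thesis using bisectors[of q q'] * by simp
    qed
  qed
  ultimately show ?thesis unfolding general_position_def by blast
qed

lemma negligible_line: "negligible {p + s *\<^sub>R unit_dir t | s. True}"
proof (rule negligible_subset)
  let ?n = "unit_dir (t + pi / 2)"
  have "?n \<noteq> 0" using norm_unit_dir[of "t + pi / 2"] by force
  thus "negligible {x. ?n \<bullet> x = ?n \<bullet> p}" by (intro negligible_hyperplane) simp
  show "{p + s *\<^sub>R unit_dir t | s. True} \<subseteq> {x. ?n \<bullet> x = ?n \<bullet> p}"
    by (auto simp: inner_add_right inner_unit_dir)
qed

lemma negligible_bisector:
  fixes p q :: "real^2"
  assumes "p \<noteq> q"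
  shows "negligible {x. dist x p = dist x q}"
proof (rule negligible_subset)
  show "negligible {x. (q - p) \<bullet> x = (q \<bullet> q - p \<bullet> p) / 2}"
    using assms by (intro negligible_hyperplane) simp
  show "{x. dist x p = dist x q} \<subseteq> {x. (q - p) \<bullet> x = (q \<bullet> q - p \<bullet> p) / 2}"
  proof (rule subsetI, unfold mem_Collect_eq)
    fix x assume "dist x p = dist x q"
    hence "(dist x p)\<^sup>2 = (dist x q)\<^sup>2" by simp
    hence "(x - p) \<bullet> (x - p) = (x - q) \<bullet> (x - q)" by (simp add: dist_norm power2_norm_eq_inner)
    thus "(q - p) \<bullet> x = (q \<bullet> q - p \<bullet> p) / 2"
      by (simp add: inner_diff_left inner_diff_right inner_commute)
  qed
qed

text \<open>
  Points are chosen one after the other; the forbidden set in each step is a finite union of null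
  sets, and a nonempty open set is not null.
\<close>
lemma general_position_in_open_sets:
  fixes U :: "nat \<Rightarrow> (real^2) set"
  assumes "\<And>i. open (U i)" "\<And>i. U i \<noteq> {}"
  obtains x where "inj_on x {..<n}" "\<And>i. i < n \<Longrightarrow> x i \<in> U i" "general_position k (x ` {..<n})"
proof -
  have "\<exists>x. inj_on x {..<n} \<and> (\<forall>i<n. x i \<in> U i) \<and> general_position k (x ` {..<n})"
  proof (induction n)
    case 0 show ?case by (simp add: general_position_def)
  next
    case (Suc n)
    then obtain x where x: "inj_on x {..<n}" "\<And>i. i < n \<Longrightarrow> x i \<in> U i"
      "general_position k (x ` {..<n})" by blast
    define P where "P = x ` {..<n}"
    have fin: "finite P" by (simp add: P_def)
    define bad where "bad = P
      \<union> (\<Union>p\<in>P. \<Union>i<k. {p + s *\<^sub>R unit_dir (2 * pi * real i / real k) | s. True})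
      \<union> (\<Union>p\<in>P. \<Union>q\<in>P. sphere p (dist p q))
      \<union> (\<Union>p\<in>P. \<Union>q\<in>P-{p}. {y. dist y p = dist y q})"
    have UN: "negligible (\<Union>a\<in>A. N a)"
      if "finite A" "\<And>a. a \<in> A \<Longrightarrow> negligible (N a)" for A and N :: "'i \<Rightarrow> (real^2) set"
      using that by (intro negligible_Union) auto
    have "negligible bad" unfolding bad_def
      by (intro negligible_Un negligible_finite UN fin finite_Diff finite_lessThan
          negligible_line negligible_sphere negligible_bisector) auto
    moreover have "\<not> negligible (U n)" using assms open_not_negligible by blast
    ultimately obtain y where y: "y \<in> U n" "y \<notin> bad" using negligible_subset by blast
    let ?x = "x(n := y)"
    have im: "?x ` {..<Suc n} = insert y P" by (auto simp: P_def lessThan_Suc)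
    have "general_position k (insert y P)"
      using y(2) x(3) by (intro general_position_insert) (auto simp: P_def[symmetric], auto simp: bad_def)
    hence "general_position k (?x ` {..<Suc n})" unfolding im .
    moreover have "inj_on ?x {..<Suc n}"
      using x(1) y(2) by (auto simp: inj_on_def bad_def P_def less_Suc_eq)
    moreover have "\<forall>i<Suc n. ?x i \<in> U i" using x(2) y(1) by (simp add: less_Suc_eq)
    ultimately show ?case by blast
  qed
  thus ?thesis using that by blast
qed

lemma general_position_exists:
  obtains P where "finite P" "card P = n" "general_position k P"
proof -
  obtain x :: "nat \<Rightarrow> real^2" where "inj_on x {..<n}" "general_position k (x ` {..<n})"
    using general_position_in_open_sets[of "\<lambda>_. UNIV" n k] by auto
  thus ?thesis using that[of "x ` {..<n}"] by (simp add: card_image)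
qed

lemma length_unblocked_le:
  assumes "unblocked k p qs" "finite P" "p \<in> P" "set qs \<subseteq> P"
  shows "length qs \<le> card P - 1"
proof -
  have "length qs = card (set qs)" using assms(1) unfolding unblocked_def by (simp add: distinct_card)
  also have "\<dots> \<le> card (P - {p})" using assms unfolding unblocked_def by (intro card_mono) auto
  finally show ?thesis using assms by simp
qed

lemma guaranteed_degree_le:
  assumes "0 < n" "finite P" "card P = n" "general_position k P"
    and "\<And>p qs. p \<in> P \<Longrightarrow> set qs \<subseteq> P \<Longrightarrow> unblocked k p qs \<Longrightarrow> length qs \<le> B"
    and d: "\<forall>P. finite P \<and> card P = n \<and> general_position k P \<longrightarrow>
      (\<exists>ps. distinct ps \<and> set ps = P \<and> d \<le> max_in_degree (ordered_yao_graph k ps))"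
  shows "d \<le> B"
proof -
  from d assms obtain ps where ps: "distinct ps" "set ps = P" "d \<le> max_in_degree (ordered_yao_graph k ps)"
    by blast
  have "ps \<noteq> []" using ps assms by auto
  with ps(1) obtain p qs where "p \<in> set ps" "set qs \<subseteq> set ps" "unblocked k p qs"
    "length qs = max_in_degree (ordered_yao_graph k ps)" by (rule max_in_degree_attained)
  thus ?thesis using assms(5)[of p qs] ps by simp
qed

text \<open>
  This is what makes the \<open>GREATEST\<close> in \<open>d_yao\<close> well defined. It needs a witness: if there were no
  point set of size \<open>n\<close> in general position, every degree would be guaranteed vacuously.
\<close>
lemma guaranteed_degree_le_trivial:
  assumes "0 < n"
    and d: "\<forall>P. finite P \<and> card P = n \<and> general_position k P \<longrightarrow>
      (\<exists>ps. distinct ps \<and> set ps = P \<and> d \<le> max_in_degree (ordered_yao_graph k ps))"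
  shows "d \<le> n - 1"
proof -
  obtain P where P: "finite P" "card P = n" "general_position k P" by (rule general_position_exists)
  show ?thesis using guaranteed_degree_le[OF assms(1) P _ d] length_unblocked_le P by blast
qed

lemma d_yao_ge:
  assumes "0 < n" "0 < k"
    and "\<And>P. finite P \<Longrightarrow> card P = n \<Longrightarrow> general_position k P \<Longrightarrow>
      \<exists>p\<in>P. \<exists>qs. set qs \<subseteq> P \<and> unblocked k p qs \<and> d \<le> length qs"
  shows "d \<le> d_yao k n"
  unfolding d_yao_def
proof (rule Greatest_le_nat)
  show "\<forall>P. finite P \<and> card P = n \<and> general_position k P \<longrightarrow>
      (\<exists>ps. distinct ps \<and> set ps = P \<and> d \<le> max_in_degree (ordered_yao_graph k ps))"
  proof (intro allI impI)
    fix P assume P: "finite P \<and> card P = n \<and> general_position k P"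
    then obtain p qs where "p \<in> P" "set qs \<subseteq> P" "unblocked k p qs" "d \<le> length qs"
      using assms(3)[of P] by blast
    with P show "\<exists>ps. distinct ps \<and> set ps = P \<and> d \<le> max_in_degree (ordered_yao_graph k ps)"
      using max_in_degree_ge[of k p qs P] assms(2) by (meson le_trans)
  qed
qed (rule guaranteed_degree_le_trivial[OF assms(1)])

lemma d_yao_le:
  assumes "0 < n" "finite P" "card P = n" "general_position k P"
    and "\<And>p qs. p \<in> P \<Longrightarrow> set qs \<subseteq> P \<Longrightarrow> unblocked k p qs \<Longrightarrow> length qs \<le> B"
  shows "d_yao k n \<le> B"
proof -
  let ?good = "\<lambda>d. \<forall>P. finite P \<and> card P = n \<and> general_position k P \<longrightarrow>
      (\<exists>ps. distinct ps \<and> set ps = P \<and> d \<le> max_in_degree (ordered_yao_graph k ps))"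
  have "?good 0" using finite_distinct_list by auto
  hence "?good (d_yao k n)"
    unfolding d_yao_def
    by (rule GreatestI_nat) (rule guaranteed_degree_le_trivial[OF assms(1)])
  with assms show ?thesis by (rule guaranteed_degree_le)
qed

lemma d_yao_le_trivial:
  assumes "0 < n"
  shows "d_yao k n \<le> n - 1"
proof -
  obtain P where P: "finite P" "card P = n" "general_position k P" by (rule general_position_exists)
  show ?thesis using d_yao_le[OF assms P] length_unblocked_le P by blast
qed

section \<open>Lower bounds from potential functions\<close>

lemma fst_coord_polar: "(q + r *\<^sub>R unit_dir t) $ 1 = q$1 + r * cos t"
  and snd_coord_polar: "(q + r *\<^sub>R unit_dir t) $ 2 = q$2 + r * sin t"
  by simp_all

lemma sin_neg_of_lower_half:
  assumes "pi < t" "t < 2 * pi" shows "sin t < 0"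
  using sin_gt_zero[of "t - pi"] assms by (simp add: sin_diff)

lemma ex_max_image:
  fixes f :: "'a \<Rightarrow> real"
  assumes "finite P" "P \<noteq> {}"
  obtains p where "p \<in> P" "\<And>q. q \<in> P \<Longrightarrow> f q \<le> f p"
  using assms Max_in[of "f ` P"] Max_ge[of "f ` P"] by (metis (no_types, lifting) empty_is_image finite_imageI imageE imageI)

text \<open>
  A point blocking \<open>q\<close> is reached from \<open>q\<close> by a step in a direction of the sector in which \<open>q\<close> sees
  \<open>p\<close>. If all these directions are at an acute angle to \<open>\<phi>\<close>, the step moves forward in direction \<open>\<phi>\<close>.
\<close>
lemma linear_potential:
  assumes "blocks k p q r" "p \<in> sector k i q" "i < k"
    and "\<And>t. 2 * pi * real i / real k \<le> t \<Longrightarrow> t < 2 * pi * (real i + 1) / real k \<Longrightarrow> 0 < cos (t - \<phi>)"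
  shows "- (r \<bullet> unit_dir \<phi>) < - (q \<bullet> unit_dir \<phi>)"
proof -
  obtain i' where i': "i' < k" "p \<in> sector k i' q" "r \<in> sector k i' q"
    using assms(1) unfolding blocks_def by blast
  have "i' = i" using i'(2) assms(2) i'(1) assms(3) by (rule sectors_disjoint)
  with i' have "r \<in> sector k i q" by simp
  then obtain a t where t: "r = q + a *\<^sub>R unit_dir t" "0 < a"
    "2 * pi * real i / real k \<le> t" "t < 2 * pi * (real i + 1) / real k" by (rule mem_sectorE)
  have "0 < a * cos (t - \<phi>)" using assms(4)[OF t(3,4)] t(2) by simp
  thus ?thesis unfolding t(1) by (simp add: inner_add_left inner_unit_dir)
qed

text \<open>
  With \<open>p\<close> a highest point: every sector lies in the upper or the lower half-plane, so a point sees \<open>p\<close>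
  in an upper sector and blocking points are higher. The height is only weakly monotone on the
  horizontal bounding rays, which is why general position enters.
\<close>
lemma star_order_two_or_four_sectors:
  assumes k: "k = 2 \<or> k = 4" and P: "finite P" "P \<noteq> {}" "general_position k P"
  shows "\<exists>p\<in>P. \<exists>qs. set qs \<subseteq> P \<and> unblocked k p qs \<and> card P - 1 \<le> length qs"
proof -
  obtain p where p: "p \<in> P" "\<And>q. q \<in> P \<Longrightarrow> q$2 \<le> p$2"
    using ex_max_image[OF P(1,2), of "\<lambda>q. q$2"] by blast
  have up: "r$2 > q$2"
    if q: "q \<in> P - {p}" and r: "r \<in> P - {p}" and b: "blocks k p q r" for q r
  proof -
    obtain i where i: "i < k" "p \<in> sector k i q" "r \<in> sector k i q"
      using b unfolding blocks_def by blast
    obtain a s where s: "p = q + a *\<^sub>R unit_dir s" "0 < a"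
      "2 * pi * real i / real k < s" "s < 2 * pi * (real i + 1) / real k"
      by (rule open_sector_of_general_position[OF P(3) p(1) _ i(1,2)]) (use q in auto)
    obtain c t where t: "r = q + c *\<^sub>R unit_dir t" "0 < c"
      "2 * pi * real i / real k < t" "t < 2 * pi * (real i + 1) / real k"
      by (rule open_sector_of_general_position[OF P(3) _ _ i(1,3)]) (use q r in auto)
    have half: "(0 < s \<and> s < pi \<and> 0 < t \<and> t < pi) \<or> (pi < s \<and> s < 2 * pi)"
    proof -
      from k i(1) consider "k = 2" "i = 0" | "k = 2" "i = 1"
        | "k = 4" "i = 0" | "k = 4" "i = 1" | "k = 4" "i = 2" | "k = 4" "i = 3" by linarith
      thus ?thesis by cases (use s(3,4) t(3,4) pi_gt_zero in \<open>(simp; fail) | (simp, linarith)\<close>)+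
    qed
    have "q$2 \<le> p$2" using p q by simp
    hence "0 \<le> a * sin s" unfolding s(1) snd_coord_polar by simp
    hence "0 \<le> sin s" using s(2) by (simp add: zero_le_mult_iff)
    hence "\<not> (pi < s \<and> s < 2 * pi)" using sin_neg_of_lower_half[of s] by auto
    hence "0 < sin t" using half sin_gt_zero by blast
    thus ?thesis unfolding t(1) snd_coord_polar using t(2) by simp
  qed
  obtain qs where "unblocked k p qs" "set qs = P - {p}" "length qs = card (P - {p})"
    by (rule unblocked_of_potential[of "P - {p}" p k "\<lambda>q. - (q$2)"]) (use P(1) up in auto)
  thus ?thesis using p(1) P(1) by (intro bexI[of _ p] exI[of _ qs]) auto
qed

text \<open>
  By the law of cosines, as the cosine of the angle is at least \<open>1/2\<close>.
\<close>
lemma closer_of_narrow_angle: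
  assumes "0 < b" "b < a" "\<bar>s - t\<bar> \<le> pi / 3"
  shows "dist (q + b *\<^sub>R unit_dir t) (q + a *\<^sub>R unit_dir s) < a"
proof -
  have "cos (pi / 3) \<le> cos \<bar>s - t\<bar>" using assms by (intro cos_monotone_0_pi_le) auto
  hence "1 / 2 \<le> cos (t - s)" using cos_minus[of "s - t"] by (simp add: cos_60)
  hence "2 * b * a * (1/2) \<le> 2 * b * a * cos (t - s)" using assms by (intro mult_left_mono) auto
  hence "(dist (q + b *\<^sub>R unit_dir t) (q + a *\<^sub>R unit_dir s))\<^sup>2 \<le> b * b + a * a - b * a"
    unfolding dist_sq_polar by (simp add: power2_eq_square)
  also have "\<dots> < a\<^sup>2" using assms by (simp add: power2_eq_square)
  finally show ?thesis using assms by (intro power2_less_imp_less[of _ a]) auto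
qed

lemma star_order_six_or_more_sectors:
  assumes k: "6 \<le> k" and P: "finite P" "p \<in> P"
  shows "\<exists>qs. set qs \<subseteq> P \<and> unblocked k p qs \<and> card P - 1 \<le> length qs"
proof -
  have closer: "dist r p < dist q p" if b: "blocks k p q r" for q r
  proof -
    obtain i where i: "i < k" "p \<in> sector k i q" "r \<in> sector k i q" "dist q r < dist q p"
      using b unfolding blocks_def by blast
    obtain a s where s: "p = q + a *\<^sub>R unit_dir s" "0 < a"
      "2 * pi * real i / real k \<le> s" "s < 2 * pi * (real i + 1) / real k"
      using i(2) by (rule mem_sectorE)
    obtain c t where t: "r = q + c *\<^sub>R unit_dir t" "0 < c"
      "2 * pi * real i / real k \<le> t" "t < 2 * pi * (real i + 1) / real k"
      using i(3) by (rule mem_sectorE)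
    have d: "dist q r = c" "dist q p = a"
      unfolding s(1) t(1) using s(2) t(2) by (simp_all add: dist_norm)
    define u w where "u = 2 * pi * real i / real k" and "w = 2 * pi / real k"
    have "2 * pi * (real i + 1) / real k = u + w"
      unfolding u_def w_def distrib_left add_divide_distrib by simp
    moreover have "w \<le> 2 * pi / 6" unfolding w_def using k by (intro divide_left_mono) auto
    ultimately have "\<bar>s - t\<bar> \<le> pi / 3"
      using s(3,4) t(3,4) unfolding u_def[symmetric] by linarith
    moreover have "c < a" using i(4) d by simp
    ultimately have "dist (q + c *\<^sub>R unit_dir t) (q + a *\<^sub>R unit_dir s) < a"
      using t(2) by (intro closer_of_narrow_angle)
    thus ?thesis using s(1) t(1) d(2) by simp
  qed
  obtain qs where "unblocked k p qs" "set qs = P - {p}" "length qs = card (P - {p})"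
    by (rule unblocked_of_potential[of "P - {p}" p k "\<lambda>q. dist q p"]) (use P(1) closer in auto)
  thus ?thesis using P by (intro exI[of _ qs]) auto
qed

text \<open>
  All directions in the third sector go down, so no point sees a highest point there. The
  remaining two sectors are convex cones with bisecting directions \<open>pi / 3\<close> and \<open>pi\<close>.
\<close>
lemma star_order_three_sectors:
  assumes P: "finite P" "P \<noteq> {}"
  shows "\<exists>p\<in>P. \<exists>qs. set qs \<subseteq> P \<and> unblocked 3 p qs \<and> card P - 1 \<le> 2 * length qs"
proof -
  obtain p where p: "p \<in> P" "\<And>q. q \<in> P \<Longrightarrow> q$2 \<le> p$2"
    using ex_max_image[OF P, of "\<lambda>q. q$2"] by blast
  define S where "S i = {q \<in> P. p \<in> sector 3 i q}" for i
  have S: "finite (S i)" "p \<notin> S i" "S i \<subseteq> P" for i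
    using P(1) not_in_own_sector by (auto simp: S_def)
  have "P - {p} \<subseteq> S 0 \<union> S 1"
  proof
    fix q assume q: "q \<in> P - {p}"
    then obtain i where i: "i < 3" "p \<in> sector 3 i q" using sectors_cover[of 3 p q] by auto
    have "i \<noteq> 2"
    proof
      assume "i = 2"
      with i(2) obtain r t where t: "p = q + r *\<^sub>R unit_dir t" "0 < r"
        "2 * pi * real 2 / real 3 \<le> t" "t < 2 * pi * (real 2 + 1) / real 3"
        using mem_sectorE by blast
      hence "sin t < 0" using pi_gt_zero by (intro sin_neg_of_lower_half) auto
      hence "r * sin t < 0" using t(2) by (simp add: mult_pos_neg)
      moreover have "q$2 \<le> p$2" using p q by simp
      ultimately show False unfolding t(1) snd_coord_polar by simp
    qed
    thus "q \<in> S 0 \<union> S 1" using q i by (auto simp: S_def less_Suc_eq numeral_3_eq_3 numeral_2_eq_2)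
  qed
  hence "card (P - {p}) \<le> card (S 0 \<union> S 1)" using S by (intro card_mono) auto
  also have "\<dots> \<le> card (S 0) + card (S 1)" by (rule card_Un_le)
  finally have card: "card P - 1 \<le> card (S 0) + card (S 1)" using p by simp
  have order: "\<exists>qs. unblocked 3 p qs \<and> set qs = S i \<and> length qs = card (S i)"
    if i: "i = 0 \<and> \<phi> = pi / 3 \<or> i = 1 \<and> \<phi> = pi" for i \<phi>
  proof -
    have "0 < cos (t - \<phi>)"
      if "2 * pi * real i / real 3 \<le> t" "t < 2 * pi * (real i + 1) / real 3" for t
      by (rule cos_gt_zero_pi) (use i that in auto)
    hence "- (r \<bullet> unit_dir \<phi>) < - (q \<bullet> unit_dir \<phi>)"
      if "q \<in> S i" "r \<in> S i" "blocks 3 p q r" for q r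
      using that i by (intro linear_potential[of 3 p q r i]) (auto simp: S_def)
    thus ?thesis
      using unblocked_of_potential[of "S i" p 3 "\<lambda>q. - (q \<bullet> unit_dir \<phi>)"] S by metis
  qed
  have "\<exists>i \<phi>. (i = 0 \<and> \<phi> = pi / 3 \<or> i = 1 \<and> \<phi> = pi) \<and> card P - 1 \<le> 2 * card (S i)"
  proof (cases "card (S 0) \<le> card (S 1)")
    case True thus ?thesis using card by (intro exI[of _ 1] exI[of _ pi]) simp
  next
    case False thus ?thesis using card by (intro exI[of _ 0] exI[of _ "pi / 3"]) simp
  qed
  then obtain i \<phi> where i: "i = 0 \<and> \<phi> = pi / 3 \<or> i = 1 \<and> \<phi> = pi" "card P - 1 \<le> 2 * card (S i)"
    by blast
  from order[OF i(1)] obtain qs where "unblocked 3 p qs" "set qs = S i" "length qs = card (S i)" by blast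
  thus ?thesis using p(1) S(3)[of i] i(2) by (intro bexI[of _ p] exI[of _ qs]) simp_all
qed


section \<open>The lower bound for five sectors\<close>

text \<open>
  The trigonometric core of the next lemma. Seen from \<open>q\<close>, let \<open>p\<close> have distance \<open>a\<close> and direction \<open>s\<close>,
  and \<open>r\<close> distance \<open>b\<close> and direction \<open>t\<close>. The hypothesis \<open>2 * a * cos (s - t) \<le> b\<close> says that \<open>r\<close> is
  at least as far from \<open>p\<close> as \<open>q\<close> is, and the conclusions say that the direction from \<open>r\<close> to \<open>p\<close> lies
  strictly between \<open>4 * pi / 5\<close> and \<open>6 * pi / 5\<close>. The reason: as \<open>b < a\<close>, the angle at \<open>q\<close> exceeds \<open>pi / 3\<close>,
  while the sector has angle \<open>2 * pi / 5\<close> only; so \<open>s\<close> and \<open>t\<close> are close to opposite ends of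
  the sector, and \<open>pi / 2 \<le> s\<close> decides which end belongs to \<open>s\<close>.
\<close>
lemma pentagon_sines:
  fixes a b s t :: real
  assumes "2 * pi / 5 \<le> s" "pi / 2 \<le> s" "s \<le> 4 * pi / 5" "2 * pi / 5 \<le> t" "t \<le> 4 * pi / 5"
    and "0 < b" "b < a" "2 * a * cos (s - t) \<le> b"
  shows "0 < a * sin (s - 4 * pi / 5) - b * sin (t - 4 * pi / 5)"
    and "0 < a * sin (6 * pi / 5 - s) - b * sin (6 * pi / 5 - t)"
proof -
  have pi: "pi > 0" by simp
  have "\<not> \<bar>s - t\<bar> \<le> pi / 3"
  proof
    assume "\<bar>s - t\<bar> \<le> pi / 3"
    hence "cos (pi / 3) \<le> cos \<bar>s - t\<bar>" by (intro cos_monotone_0_pi_le) auto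
    hence "1 / 2 \<le> cos (s - t)" by (simp add: cos_60)
    hence "2 * a * (1 / 2) \<le> 2 * a * cos (s - t)" using assms by (intro mult_left_mono) auto
    thus False using assms(6-8) by linarith
  qed
  \<comment> \<open>The alternative \<open>t > s + pi / 3\<close> is impossible because \<open>s\<close> is at least \<open>pi / 2\<close>.\<close>
  define g h where "g = s - t" and "h = 4 * pi / 5 - s"
  have g: "pi / 3 < g" "g \<le> 2 * pi / 5" and h: "0 \<le> h" "g + h \<le> 2 * pi / 5"
    using \<open>\<not> \<bar>s - t\<bar> \<le> pi / 3\<close> assms pi unfolding g_def h_def by linarith+
  have "0 < sin (h + 2 * g)" using g h by (intro sin_gt_zero) linarith+
  have "0 < sin (h + g)" using g h pi by (intro sin_gt_zero) linarith+
  have "sin (h + 2 * g) + sin h = 2 * cos g * sin (h + g)"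
    using sin_add[of "h + g" g] sin_diff[of "h + g" g] by (simp add: algebra_simps)
  have "a * sin h < a * (sin (h + 2 * g) + sin h)"
    using \<open>0 < sin (h + 2 * g)\<close> assms by simp
  also have "\<dots> = (2 * a * cos g) * sin (h + g)"
    unfolding \<open>sin (h + 2 * g) + sin h = _\<close> by simp
  also have "\<dots> \<le> b * sin (h + g)"
    using assms \<open>0 < sin (h + g)\<close> unfolding g_def by (intro mult_right_mono) auto
  finally have *: "a * sin h < b * sin (h + g)" .
  have st: "s - 4 * pi / 5 = - h" "t - 4 * pi / 5 = - (h + g)" unfolding g_def h_def by auto
  thus "0 < a * sin (s - 4 * pi / 5) - b * sin (t - 4 * pi / 5)"
    using * unfolding st sin_minus by linarith
  have "sin (3 * pi / 5 - h - g) < sin (2 * pi / 5 + h)"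
    using g h pi by (intro sin_monotone_2pi) linarith+
  moreover have "0 < sin (3 * pi / 5 - h - g)" using g h pi by (intro sin_gt_zero) linarith+
  ultimately have "b * sin (3 * pi / 5 - h - g) < a * sin (2 * pi / 5 + h)"
    using assms by (intro mult_strict_mono) auto
  moreover have st': "6 * pi / 5 - s = 2 * pi / 5 + h" "6 * pi / 5 - t = pi - (3 * pi / 5 - h - g)"
    unfolding g_def h_def by simp_all
  ultimately show "0 < a * sin (6 * pi / 5 - s) - b * sin (6 * pi / 5 - t)"
    unfolding st' sin_pi_minus by linarith
qed

lemma mem_sector_5E:
  assumes "p \<in> sector 5 i q"
  obtains r t where "p = q + r *\<^sub>R unit_dir t" "0 < r" "2 * pi / 5 * real i \<le> t" "t < 2 * pi / 5 * real i + 2 * pi / 5"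
proof -
  obtain r t where *: "p = q + r *\<^sub>R unit_dir t" "0 < r"
    "2 * pi * real i / real 5 \<le> t" "t < 2 * pi * (real i + 1) / real 5"
    using assms by (rule mem_sectorE)
  have "2 * pi * real i / real 5 = 2 * pi / 5 * real i"
    "2 * pi * (real i + 1) / real 5 = 2 * pi / 5 * real i + 2 * pi / 5"
    by (simp_all add: distrib_left add_divide_distrib)
  with * that[of r t] show ?thesis by simp
qed

text \<open>
  The directions of sectors 1 and 3 together span \<open>6 * pi / 5\<close>, more than a half-plane, so no linear
  functional can serve as a potential for them. The distance to \<open>p\<close> can: if \<open>r\<close> were at least as far
  from \<open>p\<close> as \<open>q\<close>, then \<open>p\<close> would lie in sector 2 of \<open>r\<close>.
\<close>
lemma opposite_sectors_closer:
  assumes left: "p$1 \<le> q$1"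
    and i: "i = 1 \<or> i = 3" and p: "p \<in> sector 5 i q" and r: "r \<in> sector 5 i q"
    and j: "j = 1 \<or> j = 3" and rp: "p \<in> sector 5 j r"
    and near: "dist q r < dist q p"
  shows "dist r p < dist q p"
proof (rule ccontr)
  assume far: "\<not> dist r p < dist q p"
  have pi: "pi > 0" by simp
  obtain a s where s: "p = q + a *\<^sub>R unit_dir s" "0 < a"
    "2 * pi / 5 * real i \<le> s" "s < 2 * pi / 5 * real i + 2 * pi / 5" using p by (rule mem_sector_5E)
  obtain b t where t: "r = q + b *\<^sub>R unit_dir t" "0 < b"
    "2 * pi / 5 * real i \<le> t" "t < 2 * pi / 5 * real i + 2 * pi / 5" using r by (rule mem_sector_5E)
  obtain c v where v: "p = r + c *\<^sub>R unit_dir v" "0 < c"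
    "2 * pi / 5 * real j \<le> v" "v < 2 * pi / 5 * real j + 2 * pi / 5" using rp by (rule mem_sector_5E)
  have d: "dist q r = b" "dist q p = a"
    unfolding s(1) t(1) using s(2) t(2) by (simp_all add: dist_norm)
  have ba: "b < a" using near d by simp
  have "a\<^sup>2 \<le> (dist p r)\<^sup>2" using far d s(2) by (intro power_mono) (auto simp: dist_commute)
  hence "a\<^sup>2 \<le> a\<^sup>2 + b\<^sup>2 - 2 * a * b * cos (s - t)" unfolding s(1) t(1) dist_sq_polar .
  hence "b * (2 * a * cos (s - t)) \<le> b * b" by (simp add: power2_eq_square algebra_simps)
  hence cos: "2 * a * cos (s - t) \<le> b" using t(2) by simp
  \<comment> \<open>The components of \<open>p - q = (r - q) + (p - r)\<close> orthogonal to the direction \<open>\<alpha>\<close>.\<close>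
  have triangle: "a * sin (s - \<alpha>) - b * sin (t - \<alpha>) = c * sin (v - \<alpha>)" for \<alpha>
  proof -
    have "a *\<^sub>R unit_dir s = b *\<^sub>R unit_dir t + c *\<^sub>R unit_dir v"
      using s(1) v(1) t(1) by (simp add: add.assoc)
    hence "(a *\<^sub>R unit_dir s) \<bullet> unit_dir (\<alpha> + pi / 2)
        = (b *\<^sub>R unit_dir t + c *\<^sub>R unit_dir v) \<bullet> unit_dir (\<alpha> + pi / 2)" by simp
    moreover have "cos (x - (\<alpha> + pi / 2)) = sin (x - \<alpha>)" for x
      using sin_cos_eq[of "x - \<alpha>"] cos_minus[of "x - (\<alpha> + pi / 2)"] by (simp add: algebra_simps)
    ultimately show ?thesis by (simp add: inner_add_left inner_unit_dir)
  qed
  have triangle': "a * sin (\<alpha> - s) - b * sin (\<alpha> - t) = c * sin (\<alpha> - v)" for \<alpha>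
  proof -
    have "sin (\<alpha> - x) = - sin (x - \<alpha>)" for x using sin_minus[of "x - \<alpha>"] by simp
    thus ?thesis using triangle[of \<alpha>] by simp
  qed
  have "a * cos s \<le> 0" using left unfolding s(1) fst_coord_polar by simp
  hence coss: "cos s \<le> 0" using s(2) by (simp add: mult_le_0_iff)
  have pos: "0 < c * sin (v - 4 * pi / 5)" "0 < c * sin (6 * pi / 5 - v)"
  proof -
    have "0 < c * sin (v - 4 * pi / 5) \<and> 0 < c * sin (6 * pi / 5 - v)"
      using i
    proof
      assume i1: "i = 1"
      have s': "2 * pi / 5 \<le> s" "s \<le> 4 * pi / 5" "2 * pi / 5 \<le> t" "t \<le> 4 * pi / 5"
        using s(3,4) t(3,4) i1 by simp_all
      have "pi / 2 \<le> s"
      proof (rule ccontr)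
        assume "\<not> pi / 2 \<le> s"
        hence "0 < cos s" using s' pi by (intro cos_gt_zero_pi) linarith+
        thus False using coss by simp
      qed
      thus ?thesis
        using pentagon_sines[of s t b a] s' t(2) ba cos triangle triangle' by simp
    next
      assume i3: "i = 3"
      \<comment> \<open>Reflection at the horizontal axis swaps sectors 1 and 3.\<close>
      define s' t' where "s' = 2 * pi - s" and "t' = 2 * pi - t"
      have s': "2 * pi / 5 \<le> s'" "s' \<le> 4 * pi / 5" "2 * pi / 5 \<le> t'" "t' \<le> 4 * pi / 5"
        using s(3,4) t(3,4) i3 unfolding s'_def t'_def by simp_all
      have "pi / 2 \<le> s'"
      proof (rule ccontr)
        assume "\<not> pi / 2 \<le> s'"
        hence "0 < cos s'" using s' pi by (intro cos_gt_zero_pi) linarith+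
        thus False using coss unfolding s'_def by simp
      qed
      moreover have "2 * a * cos (s' - t') \<le> b"
        using cos cos_minus[of "s - t"] unfolding s'_def t'_def by simp
      ultimately have "0 < a * sin (s' - 4 * pi / 5) - b * sin (t' - 4 * pi / 5)"
        "0 < a * sin (6 * pi / 5 - s') - b * sin (6 * pi / 5 - t')"
        using pentagon_sines[of s' t' b a] s' t(2) ba by blast+
      moreover have "2 * pi - x - 4 * pi / 5 = 6 * pi / 5 - x"
        "6 * pi / 5 - (2 * pi - x) = x - 4 * pi / 5" for x by simp_all
      ultimately show ?thesis unfolding s'_def t'_def by (simp only: triangle triangle')
    qed
    thus "0 < c * sin (v - 4 * pi / 5)" "0 < c * sin (6 * pi / 5 - v)" by auto
  qed
  have "sin (v - 4 * pi / 5) \<le> 0 \<or> sin (6 * pi / 5 - v) \<le> 0"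
    using j
  proof
    assume "j = 1"
    hence "0 \<le> sin (4 * pi / 5 - v)" using v(3,4) pi by (intro sin_ge_zero) auto
    thus ?thesis using sin_minus[of "v - 4 * pi / 5"] by simp
  next
    assume "j = 3"
    hence "0 \<le> sin (v - 6 * pi / 5)" using v(3,4) pi by (intro sin_ge_zero) auto
    thus ?thesis using sin_minus[of "v - 6 * pi / 5"] by simp
  qed
  thus False using pos v(2) by (auto simp: zero_less_mult_iff)
qed

text \<open>
  A leftmost point is seen in sectors 1, 2 or 3 only; the three classes have union \<open>P - {p}\<close>, so two of
  them contain at least two thirds of it.
\<close>
lemma star_order_five_sectors:
  assumes P: "finite P" "P \<noteq> {}"
  shows "\<exists>p\<in>P. \<exists>qs. set qs \<subseteq> P \<and> unblocked 5 p qs \<and> 2 * (card P - 1) \<le> 3 * length qs"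
proof -
  have pi: "pi > 0" by simp
  obtain p where p': "p \<in> P" "\<And>q. q \<in> P \<Longrightarrow> - (q$1) \<le> - (p$1)"
    using ex_max_image[OF P, of "\<lambda>q. - (q$1)"] by blast
  have p: "p \<in> P" "\<And>q. q \<in> P \<Longrightarrow> p$1 \<le> q$1" using p' by simp_all
  define S where "S i = {q \<in> P. p \<in> sector 5 i q}" for i
  have S: "finite (S i)" "p \<notin> S i" "S i \<subseteq> P" for i
    using P(1) not_in_own_sector by (auto simp: S_def)
  have "P - {p} \<subseteq> S 1 \<union> S 2 \<union> S 3"
  proof
    fix q assume q: "q \<in> P - {p}"
    then obtain i where i: "i < 5" "p \<in> sector 5 i q" using sectors_cover[of 5 p q] by auto
    obtain r t where t: "p = q + r *\<^sub>R unit_dir t" "0 < r"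
      "2 * pi / 5 * real i \<le> t" "t < 2 * pi / 5 * real i + 2 * pi / 5" using i(2) by (rule mem_sector_5E)
    have "p$1 \<le> q$1" using p q by simp
    hence "r * cos t \<le> 0" unfolding t(1) fst_coord_polar by simp
    hence cos: "cos t \<le> 0" using t(2) by (simp add: mult_le_0_iff)
    have "i \<noteq> 0"
    proof
      assume "i = 0"
      hence "0 < cos t" using t(3,4) pi by (intro cos_gt_zero_pi) auto
      thus False using cos by simp
    qed
    moreover have "i \<noteq> 4"
    proof
      assume "i = 4"
      hence "0 < cos (2 * pi - t)" using t(3,4) pi by (intro cos_gt_zero_pi) auto
      thus False using cos by simp
    qed
    ultimately have "i = 1 \<or> i = 2 \<or> i = 3" using i(1) by linarith
    thus "q \<in> S 1 \<union> S 2 \<union> S 3" using q i by (auto simp: S_def)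
  qed
  hence "card (P - {p}) \<le> card (S 1 \<union> S 2 \<union> S 3)" using S by (intro card_mono) auto
  also have "\<dots> \<le> card (S 1) + card (S 2) + card (S 3)"
    using card_Un_le[of "S 1 \<union> S 2" "S 3"] card_Un_le[of "S 1" "S 2"] by linarith
  finally have card: "card P - 1 \<le> card (S 1) + card (S 2) + card (S 3)" using p by simp
  have disj: "card (S i \<union> S j) = card (S i) + card (S j)" if "i \<noteq> j" "i < 5" "j < 5" for i j
    using S that sectors_disjoint by (intro card_Un_disjoint) (auto simp: S_def)
  \<comment> \<open>Two adjacent sectors span \<open>4 * pi / 5\<close>, so their common ray is at an acute angle to all their directions.\<close>
  have adjacent: "\<exists>qs. unblocked 5 p qs \<and> set qs = S i \<union> S (Suc i) \<and> length qs = card (S i \<union> S (Suc i))"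
    if i: "i < 4" for i
  proof -
    define \<phi> where "\<phi> = 2 * pi / 5 * (real i + 1)"
    have cos: "0 < cos (t - \<phi>)"
      if "j = i \<or> j = Suc i" "2 * pi * real j / real 5 \<le> t" "t < 2 * pi * (real j + 1) / real 5" for j t
      by (rule cos_gt_zero_pi) (use that pi in \<open>auto simp: \<phi>_def field_simps\<close>)
    have "- (r \<bullet> unit_dir \<phi>) < - (q \<bullet> unit_dir \<phi>)"
      if q: "q \<in> S i \<union> S (Suc i)" and b: "blocks 5 p q r" for q r
    proof -
      obtain j where j: "j = i \<or> j = Suc i" "p \<in> sector 5 j q" using q unfolding S_def by blast
      have "j < 5" using j(1) i by auto
      with b j(2) show ?thesis by (rule linear_potential) (use cos[OF j(1)] in blast)
    qed
    thus ?thesis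
      using unblocked_of_potential[of "S i \<union> S (Suc i)" p 5 "\<lambda>q. - (q \<bullet> unit_dir \<phi>)"] S
      by (metis UnE finite_UnI)
  qed
  have opposite: "\<exists>qs. unblocked 5 p qs \<and> set qs = S 1 \<union> S 3 \<and> length qs = card (S 1 \<union> S 3)"
  proof -
    have "dist r p < dist q p" if q: "q \<in> S 1 \<union> S 3" and r: "r \<in> S 1 \<union> S 3" and b: "blocks 5 p q r" for q r
    proof -
      obtain i where i: "i < 5" "p \<in> sector 5 i q" "r \<in> sector 5 i q" "dist q r < dist q p"
        using b unfolding blocks_def by blast
      obtain i' where i': "i' = 1 \<or> i' = 3" "p \<in> sector 5 i' q" using q unfolding S_def by blast
      have "i' < 5" using i'(1) by auto
      with i'(2) i(2) have "i' = i" using i(1) by (rule sectors_disjoint)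
      hence "i = 1 \<or> i = 3" using i'(1) by simp
      moreover obtain j where "j = 1 \<or> j = 3" "p \<in> sector 5 j r" using r by (auto simp: S_def)
      moreover have "p$1 \<le> q$1" using p(2) q by (auto simp: S_def)
      ultimately show ?thesis using i opposite_sectors_closer by blast
    qed
    thus ?thesis
      using unblocked_of_potential[of "S 1 \<union> S 3" p 5 "\<lambda>q. dist q p"] S by (metis UnE finite_UnI)
  qed
  have enough: "\<exists>qs. set qs \<subseteq> P \<and> unblocked 5 p qs \<and> 2 * (card P - 1) \<le> 3 * length qs"
    if "\<exists>qs. unblocked 5 p qs \<and> set qs = T \<and> length qs = card T" "T \<subseteq> P"
      "2 * (card P - 1) \<le> 3 * card T" for T
  proof -
    from that(1) obtain qs where "unblocked 5 p qs" "set qs = T" "length qs = card T" by blast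
    with that(2,3) show ?thesis by (intro exI[of _ qs]) simp
  qed
  have sub: "S i \<union> S j \<subseteq> P" for i j using S(3) by simp
  have Suc: "Suc 1 = 2" "Suc 2 = 3" by simp_all
  have "card (S 1 \<union> S 2) = card (S 1) + card (S 2)" "card (S 2 \<union> S 3) = card (S 2) + card (S 3)"
    "card (S 1 \<union> S 3) = card (S 1) + card (S 3)" by (rule disj; simp)+
  with card consider "2 * (card P - 1) \<le> 3 * card (S 1 \<union> S 2)"
    | "2 * (card P - 1) \<le> 3 * card (S 2 \<union> S 3)"
    | "2 * (card P - 1) \<le> 3 * card (S 1 \<union> S 3)" by linarith
  hence "\<exists>qs. set qs \<subseteq> P \<and> unblocked 5 p qs \<and> 2 * (card P - 1) \<le> 3 * length qs"
  proof cases
    case 1 with adjacent[of 1, unfolded Suc] sub show ?thesis by (intro enough) auto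
  next
    case 2 with adjacent[of 2, unfolded Suc] sub show ?thesis by (intro enough) auto
  next
    case 3 with opposite sub show ?thesis by (intro enough) auto
  qed
  thus ?thesis using p(1) by blast
qed


section \<open>One sector\<close>

lemma blocks_1: "blocks 1 p q r \<longleftrightarrow> p \<noteq> q \<and> r \<noteq> q \<and> dist q r < dist q p"
  using sector_1 unfolding blocks_def by (metis less_one)

lemma norm_le_sum_coords: "norm (v :: real^2) \<le> \<bar>v$1\<bar> + \<bar>v$2\<bar>"
  using norm_le_l1_cart[of v] by (simp add: sum_2)

text \<open>
  Let \<open>D\<close> be the diameter of \<open>S\<close>, attained by \<open>a\<close> and \<open>b\<close>. In a grid of width \<open>D / 8\<close> around \<open>a\<close>, the set meets at
  most \<open>17 * 17 = 289\<close> cells, and a cell has diameter below \<open>D / 4\<close>. A list for the points in a fullest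
  cell can be preceded by \<open>a\<close> or \<open>b\<close>, whichever is farther from \<open>p\<close>: it has distance at least \<open>D / 2\<close>
  from \<open>p\<close>, hence more than \<open>D / 4\<close> from every point of the cell, and blocks none of them.
\<close>
lemma nearest_neighbour_chain:
  assumes "finite S" "289 ^ L \<le> card S"
  shows "\<exists>p\<in>S. \<exists>qs. set qs \<subseteq> S \<and> unblocked 1 p qs \<and> length qs = L"
  using assms
proof (induction L arbitrary: S)
  case 0
  hence "S \<noteq> {}" by auto
  thus ?case by (auto simp: unblocked_def)
next
  case (Suc L)
  have "(1::nat) \<le> 289 ^ L" by simp
  hence two: "1 < card S" using Suc.prems(2) unfolding power_Suc by linarith
  hence "S \<noteq> {}" by auto
  obtain e where e: "e \<in> S \<times> S" "\<And>e'. e' \<in> S \<times> S \<Longrightarrow> dist (fst e') (snd e') \<le> dist (fst e) (snd e)"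
    using ex_max_image[of "S \<times> S" "\<lambda>e. dist (fst e) (snd e)"] Suc.prems(1) \<open>S \<noteq> {}\<close> by blast
  define a b where "a = fst e" and "b = snd e"
  have ab: "a \<in> S" "b \<in> S" using e(1) by (auto simp: a_def b_def)
  define D where "D = dist a b"
  have D: "dist x y \<le> D" if "x \<in> S" "y \<in> S" for x y
    using e(2)[of "(x, y)"] that by (simp add: D_def a_def b_def)
  have "D > 0"
  proof -
    obtain x y where "x \<in> S" "y \<in> S" "x \<noteq> y"
      using two card_le_Suc0_iff_eq[OF Suc.prems(1)] by (metis One_nat_def not_less)
    hence "0 < dist x y" by simp
    also have "\<dots> \<le> D" using D \<open>x \<in> S\<close> \<open>y \<in> S\<close> .
    finally show ?thesis .
  qed
  define cell where "cell q = (\<lfloor>8 * (q$1 - a$1) / D\<rfloor>, \<lfloor>8 * (q$2 - a$2) / D\<rfloor>)" for q :: "real^2"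
  define B :: "(int \<times> int) set" where "B = {-8..8} \<times> {-8..8}"
  have B: "finite B" "card B = 289" "B \<noteq> {}" unfolding B_def by simp_all
  have grid: "\<lfloor>8 * u / D\<rfloor> \<in> {-8..8}" if "\<bar>u\<bar> \<le> D" for u
  proof -
    have "- 8 \<le> 8 * u / D" "8 * u / D \<le> 8" using that \<open>D > 0\<close> by (simp_all add: field_simps)
    thus ?thesis by (simp add: floor_le_iff le_floor_iff)
  qed
  have "cell \<in> S \<rightarrow> B"
  proof
    fix q assume "q \<in> S"
    hence "norm (q - a) \<le> D" using D ab by (simp add: dist_norm[symmetric])
    hence "\<bar>q$1 - a$1\<bar> \<le> D" "\<bar>q$2 - a$2\<bar> \<le> D"
      using component_le_norm_cart[of "q - a" 1] component_le_norm_cart[of "q - a" 2] by auto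
    thus "cell q \<in> B" unfolding cell_def B_def by (intro SigmaI grid)
  qed
  from pigeonhole_card[OF this Suc.prems(1) B(1,3)] obtain y
    where y: "card S \<le> card (cell -` {y} \<inter> S) * 289" unfolding B(2) by blast
  define T where "T = cell -` {y} \<inter> S"
  have T: "finite T" "T \<subseteq> S" using Suc.prems(1) by (auto simp: T_def)
  have "289 ^ L \<le> card T" using y Suc.prems(2) unfolding T_def[symmetric] power_Suc by linarith
  from Suc.IH[OF T(1) this] obtain p qs
    where p: "p \<in> T" and qs: "set qs \<subseteq> T" "unblocked 1 p qs" "length qs = L" by blast
  have close: "dist q p < D / 4" if "q \<in> T" for q
  proof -
    have near: "\<bar>u - w\<bar> < D / 8" if "\<lfloor>8 * (u - c) / D\<rfloor> = \<lfloor>8 * (w - c) / D\<rfloor>" for u w c :: real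
    proof -
      have "\<bar>8 * (u - c) / D - 8 * (w - c) / D\<bar> < 1" using that by linarith
      moreover have "8 * (u - c) / D - 8 * (w - c) / D = 8 * (u - w) / D"
        by (simp add: right_diff_distrib diff_divide_distrib)
      ultimately have "\<bar>8 * (u - w)\<bar> / D < 1" using \<open>D > 0\<close> by simp
      hence "\<bar>8 * (u - w)\<bar> < D" using \<open>D > 0\<close> by simp
      thus ?thesis unfolding abs_mult by simp
    qed
    have "cell q = cell p" using that p by (simp add: T_def)
    hence "\<bar>q$1 - p$1\<bar> < D / 8" "\<bar>q$2 - p$2\<bar> < D / 8" 
      unfolding cell_def prod.inject by (blast intro: near)+
    thus ?thesis using norm_le_sum_coords[of "q - p"] by (simp add: dist_norm)
  qed
  obtain x where x: "x \<in> S" "D / 2 \<le> dist x p"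
  proof (cases "D / 2 \<le> dist a p")
    case False
    hence "D / 2 \<le> dist b p" using dist_triangle2[of a b p] by (simp add: D_def)
    thus ?thesis using that ab by blast
  qed (use that ab in blast)
  have far: "dist q p < dist q x" if "q \<in> T" for q
    using close[OF that] x(2) dist_triangle[of x p q] by (simp add: dist_commute)
  have "x \<notin> set qs" using qs(1) close[of x] x(2) \<open>D > 0\<close> by auto
  moreover have "x \<noteq> p" using x(2) \<open>D > 0\<close> by auto
  moreover have "\<not> blocks 1 p q x" if "q \<in> set qs" for q
    using far[of q] qs(1) that unfolding blocks_1 by auto
  ultimately have "unblocked 1 p (x # qs)"
    using qs(2) unfolding unblocked_def by simp
  thus ?case using x(1) qs(1,3) p T(2) by (intro bexI[of _ p] exI[of _ "x # qs"]) auto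
qed

lemma d_yao_1_ge:
  assumes "0 < n" "289 ^ L \<le> n"
  shows "L \<le> d_yao 1 n"
proof (rule d_yao_ge[OF assms(1)])
  fix P :: "(real^2) set" assume "finite P" "card P = n"
  thus "\<exists>p\<in>P. \<exists>qs. set qs \<subseteq> P \<and> unblocked 1 p qs \<and> L \<le> length qs"
    using nearest_neighbour_chain[of P L] assms(2) by (metis order_refl)
qed simp

lemma length_halving_list:
  fixes xs :: "nat list"
  assumes "sorted_wrt (\<lambda>a b. 2 * b \<le> a) xs" "\<And>x. x \<in> set xs \<Longrightarrow> 0 < x \<and> x \<le> N" "0 < N"
  shows "2 ^ length xs \<le> 2 * N"
  using assms
proof (induction xs arbitrary: N)
  case (Cons a xs)
  show ?case
  proof (cases "xs = []")
    case False
    then obtain x where "x \<in> set xs" by fastforce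
    hence "0 < x" "2 * x \<le> a" using Cons.prems by auto
    have "2 ^ length xs \<le> 2 * (a div 2)"
    proof (rule Cons.IH)
      show "sorted_wrt (\<lambda>a b. 2 * b \<le> a) xs" using Cons.prems(1) by simp
      show "0 < y \<and> y \<le> a div 2" if "y \<in> set xs" for y
      proof -
        have "2 * y \<le> a" "0 < y" using that Cons.prems by auto
        thus ?thesis by linarith
      qed
      show "0 < a div 2" using \<open>0 < x\<close> \<open>2 * x \<le> a\<close> by linarith
    qed
    moreover have "a \<le> N" using Cons.prems(2) by simp
    ultimately show ?thesis by simp
  qed (use Cons.prems in auto)
qed simp

text \<open>
  Points near \<open>(0, 0), (1, 0), ..., (n - 1, 0)\<close>, perturbed by so little that comparing distances
  between them weakly means comparing differences of indices. On either side of \<open>p\<close>, an unblocked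
  list must then at least halve the distance to \<open>p\<close> from each entry to the next.
\<close>
lemma d_yao_1_le:
  assumes "0 < n"
  shows "real (d_yao 1 n) \<le> log 2 (4 * (real n)\<^sup>2)"
proof -
  define U where "U i = {v :: real^2. \<bar>v$1 - real i\<bar> < 1/100 \<and> \<bar>v$2\<bar> < 1/100}" for i :: nat
  have "open (U i)" for i
    unfolding U_def by (intro open_Collect_conj open_Collect_less continuous_intros)
  moreover have "vector [real i, 0] \<in> U i" for i by (simp add: U_def)
  hence "U i \<noteq> {}" for i by blast
  ultimately obtain x where x: "inj_on x {..<n}" "\<And>i. i < n \<Longrightarrow> x i \<in> U i"
    "general_position 1 (x ` {..<n})" using general_position_in_open_sets[of U n 1] by metis
  have bound: "length qs \<le> nat \<lfloor>log 2 (4 * (real n)\<^sup>2)\<rfloor>"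
    if p: "p \<in> x ` {..<n}" and qs: "set qs \<subseteq> x ` {..<n}" "unblocked 1 p qs" for p qs
  proof -
    obtain c where c: "c < n" "p = x c" using p by auto
    define js where "js = map (inv_into {..<n} x) qs"
    have js: "map x js = qs" unfolding js_def using qs(1) by (simp add: f_inv_into_f map_idI subset_eq)
    have jn: "j < n" if "j \<in> set js" for j
      using that qs(1) inv_into_into[of _ x "{..<n}"] unfolding js_def by auto
    have jc: "j \<noteq> c" if "j \<in> set js" for j
      using that qs(2) js c(2) unfolding unblocked_def by (metis image_eqI list.set_map)
    have dist_le: "dist (x i) (x j) < \<bar>real i - real j\<bar> + 1/25" if "i < n" "j < n" for i j
      using x(2)[OF that(1)] x(2)[OF that(2)] norm_le_sum_coords[of "x i - x j"]
      unfolding U_def dist_norm mem_Collect_eq vector_minus_component by linarith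
    have dist_ge: "\<bar>real i - real j\<bar> - 1/50 < dist (x i) (x j)" if "i < n" "j < n" for i j
      using x(2)[OF that(1)] x(2)[OF that(2)] component_le_norm_cart[of "x i - x j" 1]
      unfolding U_def dist_norm mem_Collect_eq vector_minus_component by linarith
    have sorted: "sorted_wrt (\<lambda>l j. l \<noteq> j \<and> \<bar>int j - int c\<bar> \<le> \<bar>int j - int l\<bar>) js"
      unfolding sorted_wrt_iff_nth_less
    proof (intro allI impI)
      fix u v assume uv: "u < v" "v < length js"
      define l j where "l = js ! u" and "j = js ! v"
      have lj: "l < n" "j < n" "j \<noteq> c" using uv jn jc unfolding l_def j_def by auto
      have "sorted_wrt (\<lambda>r q. \<not> blocks 1 p q r) qs" "distinct qs" using qs(2) unfolding unblocked_def by auto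
      moreover have "qs ! u = x l" "qs ! v = x j" "length qs = length js"
        unfolding l_def j_def js[symmetric] using uv by simp_all
      ultimately have "\<not> blocks 1 p (x j) (x l)" "x l \<noteq> x j"
        using uv sorted_wrt_nth_less[of _ qs u v] nth_eq_iff_index_eq[of qs u v] by auto
      moreover have "x c \<noteq> x j" using inj_onD[OF x(1)] lj c by auto
      ultimately have "dist (x j) (x c) \<le> dist (x j) (x l)" unfolding blocks_1 c(2) by auto
      hence "\<bar>real j - real c\<bar> < \<bar>real j - real l\<bar> + 1"
        using dist_le[OF lj(2,1)] dist_ge[OF lj(2) c(1)] by linarith
      hence "\<bar>int j - int c\<bar> < \<bar>int j - int l\<bar> + 1" by linarith
      thus "js ! u \<noteq> js ! v \<and> \<bar>int (js ! v) - int c\<bar> \<le> \<bar>int (js ! v) - int (js ! u)\<bar>"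
        using \<open>x l \<noteq> x j\<close> unfolding l_def j_def by auto
    qed
    have right: "2 ^ length (filter (\<lambda>j. c < j) js) \<le> 2 * n"
    proof -
      let ?js = "filter (\<lambda>j. c < j) js"
      have "2 ^ length (map (\<lambda>j. j - c) ?js) \<le> 2 * n"
      proof (rule length_halving_list)
        show "sorted_wrt (\<lambda>a b. 2 * b \<le> a) (map (\<lambda>j. j - c) ?js)"
          unfolding sorted_wrt_map using sorted_wrt_filter[OF sorted]
          by (rule sorted_wrt_mono_rel[rotated]) auto
        show "0 < a \<and> a \<le> n" if "a \<in> set (map (\<lambda>j. j - c) ?js)" for a
          using that jn by (auto dest!: jn)
      qed (rule assms)
      thus ?thesis by simp
    qed
    have left: "2 ^ length (filter (\<lambda>j. \<not> c < j) js) \<le> 2 * n"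
    proof -
      let ?js = "filter (\<lambda>j. \<not> c < j) js"
      have lt: "j < c" if "j \<in> set ?js" for j using that jc[of j] by auto
      have "2 ^ length (map (\<lambda>j. c - j) ?js) \<le> 2 * n"
      proof (rule length_halving_list)
        show "sorted_wrt (\<lambda>a b. 2 * b \<le> a) (map (\<lambda>j. c - j) ?js)"
          unfolding sorted_wrt_map using sorted_wrt_filter[OF sorted]
        proof (rule sorted_wrt_mono_rel[rotated])
          fix l j assume "l \<in> set ?js" "j \<in> set ?js"
            and lj: "l \<noteq> j \<and> \<bar>int j - int c\<bar> \<le> \<bar>int j - int l\<bar>"
          hence "l < c" "j < c" using lt by blast+
          thus "2 * (c - j) \<le> c - l" using lj by auto
        qed
        show "0 < a \<and> a \<le> n" if "a \<in> set (map (\<lambda>j. c - j) ?js)" for a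
          using that lt c(1) by fastforce
      qed (rule assms)
      thus ?thesis by simp
    qed
    have "length qs = length js" using js length_map[of x js] by simp
    also have "\<dots> = length (filter (\<lambda>j. c < j) js) + length (filter (\<lambda>j. \<not> c < j) js)"
      by (rule sum_length_filter_compl[symmetric])
    finally have "2 ^ length qs = 2 ^ length (filter (\<lambda>j. c < j) js) * (2::nat) ^ length (filter (\<lambda>j. \<not> c < j) js)"
      by (simp add: power_add)
    also have "\<dots> \<le> (2 * n) * (2 * n)" using right left by (rule mult_le_mono)
    also have "\<dots> = 4 * n\<^sup>2" by (simp add: power2_eq_square)
    finally have "real (length qs) \<le> log 2 (real (4 * n\<^sup>2))" by (rule le_log2_of_power)
    thus ?thesis by (simp add: le_nat_floor)
  qed
  have "1 \<le> real n" using assms by simp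
  hence "1 \<le> 4 * (real n)\<^sup>2" using one_le_power[of "real n" 2] by linarith
  hence nonneg: "0 \<le> log 2 (4 * (real n)\<^sup>2)" by (subst zero_le_log_cancel_iff) linarith+
  have "d_yao 1 n \<le> nat \<lfloor>log 2 (4 * (real n)\<^sup>2)\<rfloor>"
    by (rule d_yao_le[OF assms _ _ x(3) bound]) (auto simp: card_image x(1))
  thus ?thesis using nonneg by linarith
qed


section \<open>The upper bound for three sectors\<close>

text \<open>
  In the coordinates \<open>(sqrt 3 * x, y)\<close> the bounding lines of the three sectors have the equations
  \<open>Y = 0\<close>, \<open>X + Y = 0\<close> and \<open>X = Y\<close>, which makes membership a matter of linear arithmetic.
\<close>
lemma sector_3I:
  defines "X \<equiv> \<lambda>v :: real^2. sqrt 3 * v$1" and "Y \<equiv> \<lambda>v :: real^2. v$2"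
  shows "Y q \<le> Y p \<Longrightarrow> X q + Y q < X p + Y p \<Longrightarrow> p \<in> sector 3 0 q"
    and "X p + Y p \<le> X q + Y q \<Longrightarrow> X p - Y p < X q - Y q \<Longrightarrow> p \<in> sector 3 1 q"
    and "Y p < Y q \<Longrightarrow> X q - Y q \<le> X p - Y p \<Longrightarrow> p \<in> sector 3 2 q"
proof -
  have pi: "pi > 0" by simp
  have polar: "\<exists>r t. p = q + r *\<^sub>R unit_dir t \<and> 0 < r \<and> 0 \<le> t \<and> t < 2 * pi \<and> Y p - Y q = r * sin t \<and>
    (X p + Y p) - (X q + Y q) = 2 * r * sin (t + pi / 3) \<and>
    (X q - Y q) - (X p - Y p) = 2 * r * sin (t - pi / 3)" if "p \<noteq> q"
  proof -
    have "p - q \<noteq> 0" using that by simp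
    then obtain r t where rt: "0 < r" "0 \<le> t" "t < 2 * pi" "p - q = r *\<^sub>R unit_dir t"
      using polar_decomposition[OF \<open>p - q \<noteq> 0\<close>] by blast
    have p: "p = q + r *\<^sub>R unit_dir t" using rt(4) by (simp add: algebra_simps)
    \<comment> \<open>The forms \<open>X + Y\<close> and \<open>Y - X\<close> are twice the sine after a rotation by \<open>pi / 3\<close>.\<close>
    have "Y p - Y q = r * sin t"
      "(X p + Y p) - (X q + Y q) = 2 * r * sin (t + pi / 3)"
      "(X q - Y q) - (X p - Y p) = 2 * r * sin (t - pi / 3)"
      by (simp_all add: p X_def Y_def sin_add sin_diff sin_60 cos_60 algebra_simps)
    with p rt(1-3) show ?thesis by blast
  qed
  have sin_nonpos: "sin u \<le> 0" if "pi \<le> u" "u \<le> 2 * pi" for u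
    using sin_ge_zero[of "u - pi"] that by (simp add: sin_diff)
  have mem: "p \<in> sector 3 i q"
    if "p = q + r *\<^sub>R unit_dir t" "0 < r" "2 * pi / 3 * real i \<le> t" "t < 2 * pi / 3 * real i + 2 * pi / 3" for i r t
  proof -
    have i: "2 * pi * real i / real 3 = 2 * pi / 3 * real i"
      "2 * pi * (real i + 1) / real 3 = 2 * pi / 3 * real i + 2 * pi / 3"
      by (simp_all add: distrib_left add_divide_distrib)
    show ?thesis unfolding sector_def mem_Collect_eq i using that by blast
  qed
  show "p \<in> sector 3 0 q" if *: "Y q \<le> Y p" "X q + Y q < X p + Y p"
  proof -
    have "p \<noteq> q" using * by auto
    from polar[OF this] obtain r t where t: "p = q + r *\<^sub>R unit_dir t" "0 < r" "0 \<le> t" "t < 2 * pi"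
      "Y p - Y q = r * sin t" "(X p + Y p) - (X q + Y q) = 2 * r * sin (t + pi / 3)" by blast
    have "0 \<le> r * sin t" "0 < 2 * r * sin (t + pi / 3)" using * t(5,6) by linarith+
    hence "0 \<le> sin t" "0 < sin (t + pi / 3)" using t(2) by (simp_all add: zero_le_mult_iff zero_less_mult_iff)
    hence "t \<le> pi" "\<not> (2 * pi / 3 \<le> t \<and> t \<le> 5 * pi / 3)"
      using sin_neg_of_lower_half[of t] sin_nonpos[of "t + pi / 3"] t(4) by force+
    thus ?thesis using t(1-3) pi by (intro mem[of r t 0]) auto
  qed
  show "p \<in> sector 3 1 q" if *: "X p + Y p \<le> X q + Y q" "X p - Y p < X q - Y q"
  proof -
    have "p \<noteq> q" using * by auto
    from polar[OF this] obtain r t where t: "p = q + r *\<^sub>R unit_dir t" "0 < r" "0 \<le> t" "t < 2 * pi"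
      "(X p + Y p) - (X q + Y q) = 2 * r * sin (t + pi / 3)"
      "(X q - Y q) - (X p - Y p) = 2 * r * sin (t - pi / 3)" by blast
    have "2 * r * sin (t + pi / 3) \<le> 0" "0 < 2 * r * sin (t - pi / 3)" using * t(5,6) by linarith+
    hence "sin (t + pi / 3) \<le> 0" "0 < sin (t - pi / 3)"
      using t(2) by (simp_all add: mult_le_0_iff zero_less_mult_iff)
    hence "\<not> t < 2 * pi / 3" "\<not> 4 * pi / 3 \<le> t"
      using sin_gt_zero[of "t + pi / 3"] sin_nonpos[of "t - pi / 3"] t(3,4) pi by force+
    thus ?thesis using t(1,2) by (intro mem[of r t 1]) auto
  qed
  show "p \<in> sector 3 2 q" if *: "Y p < Y q" "X q - Y q \<le> X p - Y p"
  proof -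
    have "p \<noteq> q" using * by auto
    from polar[OF this] obtain r t where t: "p = q + r *\<^sub>R unit_dir t" "0 < r" "0 \<le> t" "t < 2 * pi"
      "Y p - Y q = r * sin t" "(X q - Y q) - (X p - Y p) = 2 * r * sin (t - pi / 3)" by blast
    have "r * sin t < 0" "2 * r * sin (t - pi / 3) \<le> 0" using * t(5,6) by linarith+
    hence "sin t < 0" "sin (t - pi / 3) \<le> 0" using t(2) by (simp_all add: mult_le_0_iff mult_less_0_iff)
    hence "\<not> t \<le> pi" "\<not> (pi / 3 < t \<and> t < 4 * pi / 3)"
      using sin_ge_zero[of t] sin_gt_zero[of "t - pi / 3"] t(3) by force+
    thus ?thesis using t(1,2,4) pi by (intro mem[of r t 2]) auto
  qed
qed

text \<open>
  The centres of six clusters, in the coordinates \<open>(sqrt 3 * x, y)\<close>. They form three pairs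
  \<open>{0, 1}\<close>, \<open>{2, 3}\<close>, \<open>{4, 5}\<close> at the corners of an equilateral triangle; rotation by \<open>2 * pi / 3\<close>, which is
  \<open>(X, Y) \<mapsto> (- (X + 3 * Y) / 2, (X - Y) / 2)\<close> here, maps each pair to the next one. The first pair is
  steep, with direction \<open>(3, 4)\<close>, and the second one is almost horizontal and far to the right, at
  a height between the two points of the first. So the lower point of the first pair sees
  the second pair and its partner in sector 0, and the upper one sees the second pair and
  its partner in sector 2.
\<close>
definition center :: "nat \<Rightarrow> real \<times> real" where
  "center j = [(-63, -24), (-57, -16), (67.5, -19.5), (52.5, -20.5), (-4.5, 43.5), (4.5, 36.5)] ! j"

definition box_at :: "nat \<Rightarrow> (real^2) set" where
  "box_at j = {v. fst (center j) - 1/10 < sqrt 3 * v$1 \<and> sqrt 3 * v$1 < fst (center j) + 1/10 \<and>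
     snd (center j) - 1/10 < v$2 \<and> v$2 < snd (center j) + 1/10}"

lemma center_simps:
  "center 0 = (-63, -24)" "center 1 = (-57, -16)" "center 2 = (67.5, -19.5)"
  "center 3 = (52.5, -20.5)" "center 4 = (-4.5, 43.5)" "center 5 = (4.5, 36.5)"
  by (simp_all add: center_def)

lemma open_box_at: "open (box_at j)"
  unfolding box_at_def by (intro open_Collect_conj open_Collect_less continuous_intros)

lemma box_at_nonempty: "box_at j \<noteq> {}"
proof -
  have "vector [fst (center j) / sqrt 3, snd (center j)] \<in> box_at j" by (simp add: box_at_def)
  thus ?thesis by blast
qed

text \<open>
  In the scaled coordinates, three times the squared distance is \<open>X\<^sup>2 + 3 * Y\<^sup>2\<close>, and
  \<open>16\<^sup>2 + 3 * 9\<^sup>2 = 499\<close> is less than \<open>40\<^sup>2\<close>.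
\<close>
lemma dist_less_scaled:
  fixes p q r :: "real^2"
  assumes "\<bar>sqrt 3 * q$1 - sqrt 3 * r$1\<bar> \<le> 16" "\<bar>q$2 - r$2\<bar> \<le> 9" "40 \<le> \<bar>sqrt 3 * q$1 - sqrt 3 * p$1\<bar>"
  shows "dist q r < dist q p"
proof -
  have sq: "3 * (dist q v)\<^sup>2 = (sqrt 3 * q$1 - sqrt 3 * v$1)\<^sup>2 + 3 * (q$2 - v$2)\<^sup>2" for v
    unfolding dist_norm norm_real2
    by (simp add: right_diff_distrib[symmetric] power_mult_distrib)
  have "(sqrt 3 * q$1 - sqrt 3 * r$1)\<^sup>2 \<le> 16\<^sup>2" "(q$2 - r$2)\<^sup>2 \<le> 9\<^sup>2"
    using assms(1,2) by (simp_all only: abs_le_square_iff[symmetric] abs_numeral)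
  hence "3 * (dist q r)\<^sup>2 \<le> 16\<^sup>2 + 3 * 9\<^sup>2" unfolding sq by linarith
  also have "\<dots> < (40 :: real)\<^sup>2" by simp
  also have "\<dots> \<le> (sqrt 3 * q$1 - sqrt 3 * p$1)\<^sup>2"
    using assms(3) by (simp only: abs_le_square_iff[symmetric] abs_numeral)
  also have "\<dots> \<le> 3 * (dist q p)\<^sup>2" unfolding sq by simp
  finally have "(dist q r)\<^sup>2 < (dist q p)\<^sup>2" by simp
  thus ?thesis by (rule power2_less_imp_less) simp
qed

text \<open>
  The pair that precedes the pair of \<open>j\<close> in the rotation.
\<close>
definition witness_pair :: "nat \<Rightarrow> nat \<times> nat" where
  "witness_pair j = (if j < 2 then (4, 5) else if j < 4 then (0, 1) else (2, 3))"

lemma witness_pair_blocks: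
  assumes j: "j < 6" and p: "p \<in> box_at j"
    and q: "q \<in> box_at (fst (witness_pair j))" and r: "r \<in> box_at (snd (witness_pair j))"
  shows "blocks 3 p q r" "blocks 3 p r q"
proof -
  define x where "x v = sqrt 3 * v$1" for v :: "real^2"
  have box: "fst (center i) - 1/10 < x v \<and> x v < fst (center i) + 1/10 \<and>
     snd (center i) - 1/10 < v$2 \<and> v$2 < snd (center i) + 1/10" if "v \<in> box_at i" for v i
    using that by (simp add: box_at_def x_def)
  \<comment> \<open>The bounds on \<open>x p - p$2\<close> and \<open>x p + p$2\<close> below are needed because the coordinates differ too much between the two clusters of the pair of \<open>p\<close>, while these combinations hardly change.\<close>
  from j consider "j = 0 \<or> j = 1" | "j = 2 \<or> j = 3" | "j = 4 \<or> j = 5" by linarith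
  hence "blocks 3 p q r \<and> blocks 3 p r q"
  proof cases
    case 1
    have "-64 < x p \<and> x p < -56 \<and> -25 < p$2 \<and> p$2 < -15 \<and> -42 < x p - p$2 \<and> x p - p$2 < -38"
      using 1
    proof
      assume "j = 0" with box[OF p] show ?thesis by (simp add: center_simps)
    next
      assume "j = 1" with box[OF p] show ?thesis by (simp add: center_simps del: One_nat_def)
    qed
    hence pb: "-64 < x p" "x p < -56" "-25 < p$2" "p$2 < -15" "-42 < x p - p$2" "x p - p$2 < -38" by blast+
    have qb: "-4.5 - 1/10 < x q" "x q < -4.5 + 1/10"
      "43.5 - 1/10 < q$2" "q$2 < 43.5 + 1/10"
      using box[OF q] 1 by (auto simp: witness_pair_def center_simps simp del: One_nat_def)
    have rb: "4.5 - 1/10 < x r" "x r < 4.5 + 1/10"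
      "36.5 - 1/10 < r$2" "r$2 < 36.5 + 1/10"
      using box[OF r] 1 by (auto simp: witness_pair_def center_simps simp del: One_nat_def)
    note bounds = pb qb rb
    have "p \<in> sector 3 2 q" "r \<in> sector 3 2 q" "p \<in> sector 3 1 r" "q \<in> sector 3 1 r"
      by (rule sector_3I; insert bounds; unfold x_def; linarith)+
    moreover have "dist q r < dist q p" "dist r q < dist r p"
      by (rule dist_less_scaled; insert bounds; unfold x_def; linarith)+
    ultimately show ?thesis unfolding blocks_def by (intro conjI exI[of _ 2] exI[of _ 1]) auto
  next
    case 2
    have "52 < x p \<and> x p < 68 \<and> -21 < p$2 \<and> p$2 < -19"
      using 2
    proof
      assume "j = 2" with box[OF p] show ?thesis by (simp add: center_simps)
    next
      assume "j = 3" with box[OF p] show ?thesis by (simp add: center_simps del: One_nat_def)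
    qed
    hence pb: "52 < x p" "x p < 68" "-21 < p$2" "p$2 < -19" by blast+
    have qb: "-63 - 1/10 < x q" "x q < -63 + 1/10"
      "-24 - 1/10 < q$2" "q$2 < -24 + 1/10"
      using box[OF q] 2 by (auto simp: witness_pair_def center_simps simp del: One_nat_def)
    have rb: "-57 - 1/10 < x r" "x r < -57 + 1/10"
      "-16 - 1/10 < r$2" "r$2 < -16 + 1/10"
      using box[OF r] 2 by (auto simp: witness_pair_def center_simps simp del: One_nat_def)
    note bounds = pb qb rb
    have "p \<in> sector 3 0 q" "r \<in> sector 3 0 q" "p \<in> sector 3 2 r" "q \<in> sector 3 2 r"
      by (rule sector_3I; insert bounds; unfold x_def; linarith)+
    moreover have "dist q r < dist q p" "dist r q < dist r p"
      by (rule dist_less_scaled; insert bounds; unfold x_def; linarith)+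
    ultimately show ?thesis unfolding blocks_def by (intro conjI exI[of _ 0] exI[of _ 2]) auto
  next
    case 3
    have "-5 < x p \<and> x p < 5 \<and> 36 < p$2 \<and> p$2 < 44 \<and> 38 < x p + p$2 \<and> x p + p$2 < 42"
      using 3
    proof
      assume "j = 4" with box[OF p] show ?thesis by (simp add: center_simps)
    next
      assume "j = 5" with box[OF p] show ?thesis by (simp add: center_simps del: One_nat_def)
    qed
    hence pb: "-5 < x p" "x p < 5" "36 < p$2" "p$2 < 44" "38 < x p + p$2" "x p + p$2 < 42" by blast+
    have qb: "67.5 - 1/10 < x q" "x q < 67.5 + 1/10"
      "-19.5 - 1/10 < q$2" "q$2 < -19.5 + 1/10"
      using box[OF q] 3 by (auto simp: witness_pair_def center_simps simp del: One_nat_def)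
    have rb: "52.5 - 1/10 < x r" "x r < 52.5 + 1/10"
      "-20.5 - 1/10 < r$2" "r$2 < -20.5 + 1/10"
      using box[OF r] 3 by (auto simp: witness_pair_def center_simps simp del: One_nat_def)
    note bounds = pb qb rb
    have "p \<in> sector 3 1 q" "r \<in> sector 3 1 q" "p \<in> sector 3 0 r" "q \<in> sector 3 0 r"
      by (rule sector_3I; insert bounds; unfold x_def; linarith)+
    moreover have "dist q r < dist q p" "dist r q < dist r p"
      by (rule dist_less_scaled; insert bounds; unfold x_def; linarith)+
    ultimately show ?thesis unfolding blocks_def by (intro conjI exI[of _ 1] exI[of _ 0]) auto
  qed
  thus "blocks 3 p q r" "blocks 3 p r q" by auto
qed

lemma unblocked_no_two_cycle:
  assumes "unblocked k p qs" "q \<in> set qs" "r \<in> set qs" "q \<noteq> r" "blocks k p q r" "blocks k p r q"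
  shows False
proof -
  obtain u v where uv: "u < length qs" "qs ! u = q" "v < length qs" "qs ! v = r"
    using assms(2,3) by (auto simp: in_set_conv_nth)
  have "u \<noteq> v" using uv assms(4) by auto
  moreover have sorted: "sorted_wrt (\<lambda>r q. \<not> blocks k p q r) qs"
    using assms(1) unfolding unblocked_def by simp
  have "\<not> u < v" using sorted_wrt_nth_less[OF sorted _ uv(3), of u] uv assms(6) by auto
  moreover have "\<not> v < u" using sorted_wrt_nth_less[OF sorted _ uv(1), of v] uv assms(5) by auto
  ultimately show False by simp
qed

text \<open>
  The \<open>6 * m\<close> points are distributed cyclically over the clusters, \<open>m\<close> to each. Let \<open>p\<close> be any of them. The
  witness pair of its cluster provides \<open>m\<close> disjoint two-cycles, and every unblocked list omits a point of
  each; besides these \<open>m\<close> points, it omits \<open>p\<close> itself. A subset of the point set inherits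
  the bound, which covers \<open>n\<close> that are not divisible by six.
\<close>
lemma d_yao_3_le:
  assumes "0 < n" "n \<le> 6 * m"
  shows "d_yao 3 n \<le> 5 * m - 1"
proof -
  define U where "U i = box_at (i mod 6)" for i
  obtain x where x: "inj_on x {..<6*m}" "\<And>i. i < 6*m \<Longrightarrow> x i \<in> U i"
    "general_position 3 (x ` {..<6*m})"
    using general_position_in_open_sets[of U "6*m" 3] open_box_at box_at_nonempty unfolding U_def by metis
  have sub: "x ` {..<n} \<subseteq> x ` {..<6*m}" using assms(2) by (intro image_mono) auto
  have bound: "length qs \<le> 5 * m - 1"
    if p: "p \<in> x ` {..<n}" and qs: "set qs \<subseteq> x ` {..<n}" "unblocked 3 p qs" for p qs
  proof -
    obtain c where c: "c < 6*m" "p = x c" using p sub by auto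
    define a b where "a = fst (witness_pair (c mod 6))" and "b = snd (witness_pair (c mod 6))"
    have ab: "a < 6" "b < 6" "a \<noteq> b" "a \<noteq> c mod 6" "b \<noteq> c mod 6"
      unfolding a_def b_def witness_pair_def by auto
    define J where "J = {j. j < 6*m \<and> x j \<in> set qs}"
    have J: "J \<subseteq> {..<6*m}" "c \<notin> J" using qs(2) c(2) by (auto simp: J_def unblocked_def)
    have "set qs \<subseteq> x ` {..<6*m}" using qs(1) sub by (rule subset_trans)
    hence "x ` J = set qs" unfolding J_def by blast
    hence "card J = card (set qs)" using inj_on_subset[OF x(1) J(1)] by (metis card_image)
    also have "\<dots> = length qs" using qs(2) by (simp add: unblocked_def distinct_card)
    finally have len: "card J = length qs" .
    have missing: "6 * t + a \<notin> J \<or> 6 * t + b \<notin> J" if t: "t < m" for t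
    proof (rule ccontr)
      assume "\<not> ?thesis"
      hence in_qs: "x (6 * t + a) \<in> set qs" "x (6 * t + b) \<in> set qs" by (auto simp: J_def)
      have lt: "6 * t + a < 6 * m" "6 * t + b < 6 * m" using t ab by linarith+
      have "x (6 * t + a) \<in> box_at a" "x (6 * t + b) \<in> box_at b" "p \<in> box_at (c mod 6)"
        using x(2)[OF lt(1)] x(2)[OF lt(2)] x(2)[OF c(1)] ab c(2) unfolding U_def by simp_all
      hence "blocks 3 p (x (6 * t + a)) (x (6 * t + b))" "blocks 3 p (x (6 * t + b)) (x (6 * t + a))"
        using witness_pair_blocks[of "c mod 6" p] unfolding a_def b_def by simp_all
      moreover have "x (6 * t + a) \<noteq> x (6 * t + b)"
        using inj_onD[OF x(1), of "6 * t + a" "6 * t + b"] lt ab(3) by auto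
      ultimately show False using unblocked_no_two_cycle[OF qs(2) in_qs] by blast
    qed
    define g where "g t = (if 6 * t + a \<in> J then 6 * t + b else 6 * t + a)" for t
    have g: "g t < 6 * m" "g t \<notin> J" "g t \<noteq> c" if "t < m" for t
    proof -
      show "g t < 6 * m" using that ab by (auto simp: g_def)
      show "g t \<notin> J" using missing[OF that] by (auto simp: g_def)
      have "g t mod 6 = a \<or> g t mod 6 = b" using ab by (auto simp: g_def)
      thus "g t \<noteq> c" using ab by auto
    qed
    have "g t div 6 = t" for t using ab by (auto simp: g_def)
    hence "inj_on g {..<m}" by (metis inj_onI)
    have "card (insert c (g ` {..<m})) = Suc m"
      using g \<open>inj_on g {..<m}\<close> by (subst card_insert_disjoint) (auto simp: card_image)
    moreover have "card (insert c (g ` {..<m})) \<le> card ({..<6*m} - J)"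
      using g c(1) J(2) by (intro card_mono) auto
    moreover have "card ({..<6*m} - J) = 6 * m - card J" using J(1) by (simp add: card_Diff_subset finite_subset)
    ultimately show ?thesis unfolding len by linarith
  qed
  show ?thesis
  proof (rule d_yao_le[OF assms(1) _ _ _ bound])
    show "card (x ` {..<n}) = n" using inj_on_subset[OF x(1), of "{..<n}"] assms(2) by (simp add: card_image)
    show "general_position 3 (x ` {..<n})" using x(3) sub by (rule general_position_subset)
  qed auto
qed


section \<open>Bounds for each number of sectors\<close>

lemma d_yao_eq_of_star_orders:
  assumes "0 < n" "0 < k"
    and "\<And>P. finite P \<Longrightarrow> P \<noteq> {} \<Longrightarrow> general_position k P \<Longrightarrow>
      \<exists>p\<in>P. \<exists>qs. set qs \<subseteq> P \<and> unblocked k p qs \<and> card P - 1 \<le> length qs"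
  shows "d_yao k n = n - 1"
proof (rule antisym)
  show "n - 1 \<le> d_yao k n"
  proof (rule d_yao_ge[OF assms(1,2)])
    fix P :: "(real^2) set" assume "finite P" "card P = n" "general_position k P"
    thus "\<exists>p\<in>P. \<exists>qs. set qs \<subseteq> P \<and> unblocked k p qs \<and> n - 1 \<le> length qs"
      using assms(1) assms(3)[of P] by force
  qed
qed (rule d_yao_le_trivial[OF assms(1)])

lemma d_yao_1_bigtheta: "(\<lambda>n. real (d_yao 1 n)) \<in> \<Theta>(\<lambda>n. ln (real n))"
proof (rule bigthetaI)
  have "eventually (\<lambda>n. norm (real (d_yao 1 n)) \<le> (4 / ln 2) * norm (ln (real n))) sequentially"
    using eventually_ge_at_top[of 2]
  proof eventually_elim
    case (elim n)
    have ln: "ln 2 \<le> ln (real n)" "0 < ln (2::real)" using elim by auto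
    have "real (d_yao 1 n) \<le> log 2 (4 * (real n)\<^sup>2)" using elim by (intro d_yao_1_le) simp
    also have "\<dots> = (2 * ln 2 + 2 * ln (real n)) / ln 2"
      using elim ln_realpow[of 2 2] by (simp add: log_def ln_mult ln_realpow)
    also have "\<dots> \<le> 4 * ln (real n) / ln 2" using ln by (intro divide_right_mono) auto
    finally have "real (d_yao 1 n) \<le> 4 * ln (real n) / ln 2" .
    moreover have "\<bar>ln (real n)\<bar> = ln (real n)" using ln by linarith
    ultimately show ?case by simp
  qed
  thus "(\<lambda>n. real (d_yao 1 n)) \<in> O(\<lambda>n. ln (real n))" by (rule bigoI)
next
  have "eventually (\<lambda>n. norm (ln (real n)) \<le> (2 * ln 289) * norm (real (d_yao 1 n))) sequentially"
    using eventually_ge_at_top[of "289\<^sup>2"]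
  proof eventually_elim
    case (elim n)
    define L where "L = nat \<lfloor>log 289 (real n)\<rfloor>"
    have n: "289\<^sup>2 \<le> real n" using elim by (metis of_nat_le_iff of_nat_numeral of_nat_power)
    have l: "0 < ln (289::real)" by simp
    have "ln ((289::real)\<^sup>2) \<le> ln (real n)" using n by (subst ln_le_cancel_iff) auto
    hence ln: "2 * ln 289 \<le> ln (real n)" using ln_realpow[of 289 2] by simp
    hence two: "2 \<le> log 289 (real n)" using l by (simp add: log_def le_divide_eq)
    have "real (289 ^ L) = 289 powr real L" by (simp add: powr_realpow)
    also have "\<dots> \<le> 289 powr (log 289 (real n))" using two by (simp add: L_def)
    also have "\<dots> = real n" using n by simp
    finally have "289 ^ L \<le> n" by (simp only: of_nat_le_iff)
    hence "L \<le> d_yao 1 n" using elim by (intro d_yao_1_ge) auto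
    hence "log 289 (real n) - 1 \<le> real (d_yao 1 n)" using two unfolding L_def by linarith
    hence "log 289 (real n) / 2 \<le> real (d_yao 1 n)" using two by linarith
    hence "ln (real n) \<le> 2 * ln 289 * real (d_yao 1 n)" using l by (simp add: log_def field_simps)
    moreover have "\<bar>ln (real n)\<bar> = ln (real n)" using ln l by linarith
    ultimately show ?case by simp
  qed
  thus "(\<lambda>n. real (d_yao 1 n)) \<in> \<Omega>(\<lambda>n. ln (real n))"
    unfolding bigomega_iff_bigo by (rule bigoI)
qed

lemma d_yao_3_bounds:
  assumes "0 < n"
  shows "1 / 2 * (real n - 1) \<le> real (d_yao 3 n)"
    and "real (d_yao 3 n) \<le> 5 * real_of_int \<lceil>real n / 6\<rceil> - 1"
proof -
  have "n div 2 \<le> d_yao 3 n"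
  proof (rule d_yao_ge[OF assms])
    fix P :: "(real^2) set" assume P: "finite P" "card P = n"
    hence "P \<noteq> {}" using assms by auto
    then obtain p qs where "p \<in> P" "set qs \<subseteq> P" "unblocked 3 p qs" "card P - 1 \<le> 2 * length qs"
      using star_order_three_sectors[OF P(1)] by blast
    moreover from this P(2) have "n div 2 \<le> length qs" by linarith
    ultimately show "\<exists>p\<in>P. \<exists>qs. set qs \<subseteq> P \<and> unblocked 3 p qs \<and> n div 2 \<le> length qs" by blast
  qed simp
  hence "n \<le> 2 * d_yao 3 n + 1" by linarith
  hence "real n \<le> real (2 * d_yao 3 n + 1)" by (simp only: of_nat_le_iff)
  thus "1 / 2 * (real n - 1) \<le> real (d_yao 3 n)" by simp
  define m where "m = nat \<lceil>real n / 6\<rceil>"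
  have m: "real m = real_of_int \<lceil>real n / 6\<rceil>" using assms by (simp add: m_def)
  have "real n / 6 \<le> real m" unfolding m by (rule le_of_int_ceiling)
  hence nm: "n \<le> 6 * m" by linarith
  hence "d_yao 3 n \<le> 5 * m - 1" by (rule d_yao_3_le[OF assms])
  moreover have "0 < m" using nm assms by simp
  ultimately have "real (d_yao 3 n) \<le> 5 * real m - 1" by linarith
  thus "real (d_yao 3 n) \<le> 5 * real_of_int \<lceil>real n / 6\<rceil> - 1" unfolding m .
qed

lemma d_yao_5_ge:
  assumes "0 < n"
  shows "2 / 3 * (real n - 1) \<le> real (d_yao 5 n)"
proof -
  have "2 * n div 3 \<le> d_yao 5 n"
  proof (rule d_yao_ge[OF assms])
    fix P :: "(real^2) set" assume P: "finite P" "card P = n"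
    hence "P \<noteq> {}" using assms by auto
    then obtain p qs where "p \<in> P" "set qs \<subseteq> P" "unblocked 5 p qs" "2 * (card P - 1) \<le> 3 * length qs"
      using star_order_five_sectors[OF P(1)] by blast
    moreover from this P(2) have "2 * n div 3 \<le> length qs" by linarith
    ultimately show "\<exists>p\<in>P. \<exists>qs. set qs \<subseteq> P \<and> unblocked 5 p qs \<and> 2 * n div 3 \<le> length qs" by blast
  qed simp
  hence "2 * n \<le> 3 * d_yao 5 n + 2" by linarith
  hence "real (2 * n) \<le> real (3 * d_yao 5 n + 2)" by (simp only: of_nat_le_iff)
  thus ?thesis by simp
qed

lemma d_yao_other:
  assumes "k = 2 \<or> k = 4 \<or> k \<ge> 6" "0 < n"
  shows "d_yao k n = n - 1"
proof (rule d_yao_eq_of_star_orders)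
  fix P :: "(real^2) set" assume P: "finite P" "P \<noteq> {}" "general_position k P"
  show "\<exists>p\<in>P. \<exists>qs. set qs \<subseteq> P \<and> unblocked k p qs \<and> card P - 1 \<le> length qs"
  proof (cases "k \<ge> 6")
    case True
    obtain p where "p \<in> P" using P(2) by blast
    with star_order_six_or_more_sectors[OF True P(1)] show ?thesis by blast
  next
    case False
    with assms(1) have "k = 2 \<or> k = 4" by blast
    thus ?thesis using P by (rule star_order_two_or_four_sectors)
  qed
qed (use assms in auto)

theorem theorem1:
  shows "(\<lambda>n. real (d_yao 1 n)) \<in> \<Theta>(\<lambda>n. ln (real n)) \<and>
    (\<forall>n::nat. n > 0 \<longrightarrow>
      1 / 2 * (real n - 1) \<le> real (d_yao 3 n) \<and>
      real (d_yao 3 n) \<le> 5 * real_of_int \<lceil>real n / 6\<rceil> - 1) \<and>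
    (\<forall>n::nat. n > 0 \<longrightarrow>
      2 / 3 * (real n - 1) \<le> real (d_yao 5 n) \<and> real (d_yao 5 n) \<le> real n - 1) \<and>
    (\<forall>k n :: nat. (k = 2 \<or> k = 4 \<or> k \<ge> 6) \<and> n > 0 \<longrightarrow> real (d_yao k n) = real n - 1)"
proof (intro conjI allI impI)
  show "(\<lambda>n. real (d_yao 1 n)) \<in> \<Theta>(\<lambda>n. ln (real n))" by (rule d_yao_1_bigtheta)
  fix n :: nat assume n: "n > 0"
  show "1 / 2 * (real n - 1) \<le> real (d_yao 3 n)" using n by (rule d_yao_3_bounds)
  show "real (d_yao 3 n) \<le> 5 * real_of_int \<lceil>real n / 6\<rceil> - 1" using n by (rule d_yao_3_bounds)
  show "2 / 3 * (real n - 1) \<le> real (d_yao 5 n)" using n by (rule d_yao_5_ge)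
  show "real (d_yao 5 n) \<le> real n - 1" using d_yao_le_trivial[OF n, of 5] n by linarith
next
  fix k n :: nat assume "(k = 2 \<or> k = 4 \<or> k \<ge> 6) \<and> n > 0"
  thus "real (d_yao k n) = real n - 1" using d_yao_other[of k n] by (simp add: of_nat_diff)
qed


end
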